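(* Setting: Let $M>0$, let $\mathscr{M}$ be a finite set of integers greater than $M$, with residue classes $a_m\bmod m$ for $m\in\mathscr{M}$. Let $Q=\operatorname{lcm}(m:m\in\mathscr{M})$, $v_p=v_p(Q)$, $1=P_{-1}<P_0<P_1<\cdots$ with $P_0\ge2$, $Q_{-1}=1$, $Q_i=\prod_{p\le P_i}p^{v_p}$ ($i\ge0$), $\mathscr{M}_i=\{m\in\mathscr{M}:m\mid Q_i\}$, $R_{-1}=\mathbb{Z}$, $R_i=\bigcap_{m\in\mathscr{M}_i}(a_m\bmod m)^c$ ($i\ge0$), with $R_0\ne\emptyset$. Fix $\lambda>0$, and let $R_i^*$, $\mu_i$, $\beta_k(i)$ be as in the context. Claim: Let $i\ge0$ and $0<\pi^{\mathrm{good}}<1$. Suppose $R_{i-1}^*\cap R_i$ is non-empty (with $\mu_i(R_{i-1}^*\cap R_i)>0$), and suppose $$\prod_{P_i<p\le P_{i+1}}\Big(1+\frac{e^{\lambda}}{p-1}\Big)\le\frac{1-e^{-\lambda}}{e^{\lambda}}\max_{k\ge1}\frac{(1-\pi^{\mathrm{good}})^{1/k}}{\beta_k(i)}\Big(\sum_{P_i<p\le P_{i+1}}\frac{1}{(p-1)^k}\Big)^{-1/k}.$$ Then the set $R_i^*\subset R_{i-1}^*\cap R_i$ (defined modulo $Q_i$) satisfies $\mu_i(R_i^* )/\mu_i(R_{i-1}^*\cap R_i)\ge\pi^{\mathrm{good}}$; the density of $R_{i+1}$ in each fibre $r\bmod Q_i$ with $r\in R_i^*$ is positive; and the bias statistics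 of $R_i^*\cap R_{i+1}$ with respect to $\mu_{i+1}$ satisfy, for $k=1,2,\dots$, $$\beta_k^k(i+1)\le\frac{\beta_k^k(i)}{\pi^{\mathrm{good}}}\prod_{P_i<p\le P_{i+1}}\Big(1+e^{\lambda}\sum_{j=1}^{v_p}\frac{(j+1)^k-j^k}{p^j}\Big).$$
   Context: $(a\bmod m)$ is the set of integers $\equiv a$ mod $m$; $X^c$ is the complement in $\mathbb{Z}$; for $S\subset\mathbb{Z}$ periodic mod $q$, $|S\bmod q|$ is the number of residue classes mod $q$ in $S$, and $S$ is identified with a subset of $\mathbb{Z}/q\mathbb{Z}$. $\omega(n)$ is the number of distinct prime factors of $n$; sums and products over $p$ are over primes. For $i\ge0$: $\mathcal{N}_{i+1}=\{n:n\mid Q_{i+1},n>1,p\mid n\Rightarrow P_i<p\le P_{i+1}\}$; $A_{n,r}=(r\bmod Q_i)\cap\bigcup_{m_0\mid Q_i,\,m_0n\in\mathscr{M}_{i+1}}(a_{m_0n}\bmod m_0n)$. A class $r\in R_i\bmod Q_i$ is $\lambda$-good if for every prime $p\in(P_i,P_{i+1}]$, $\sum_{n\in\mathcal{N}_{i+1},p\mid n}|A_{n,r}\bmod nQ_i|e^{\lambda\omega(n)}/n\le1-e^{-\lambda}$. $R_{-1}^*=\mathbb{Z}$, and for $i\ge0$, $R_i^*$ is the union of the $\lambda$-good classes $r\bmod Q_i$ with $r\in R_{i-1}^*\cap R_i$. $\mu_0$ gives mass $1/|R_0\bmod Q_0|$ to each class of $R_0$ mod $Q_0$ and $0$ elsewhere;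 $\mu_{i+1}$ on $\mathbb{Z}/Q_{i+1}\mathbb{Z}$ is supported on $R_i^*\cap R_{i+1}$ with $\mu_{i+1}(r)=\mu_i(r\bmod Q_i)/|R_{i+1}\cap(r\bmod Q_i)\bmod Q_{i+1}|$. $\ell_k(m)$ is the number of $k$-tuples of natural numbers with lcm $m$. The $k$th bias statistic $\beta_k(i)\ge0$ is defined by $\beta_k^k(i)=\sum_{m\mid Q_i}\ell_k(m)\max_{b\bmod m}\frac{\mu_i(R_{i-1}^*\cap R_i\cap(b\bmod m))}{\mu_i(R_{i-1}^*\cap R_i)}$. *)

theory Defs
  imports "HOL-Number_Theory.Number_Theory" "HOL-Library.Extended_Nonnegative_Real"
begin

definition res_class :: "int \<Rightarrow> nat \<Rightarrow> int set" where
  "res_class a m = {x. [x = a] (mod int m)}"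

text \<open>A subset of the integers that is periodic modulo \<open>q\<close> is identified with the set of its least
  nonnegative residues.\<close>

definition classes_mod :: "nat \<Rightarrow> int set \<Rightarrow> int set" where
  "classes_mod q S = (\<lambda>x. x mod int q) ` S"

definition num_classes :: "nat \<Rightarrow> int set \<Rightarrow> nat" where
  "num_classes q S = card (classes_mod q S)"

definition omega :: "nat \<Rightarrow> nat" where
  "omega n = card (prime_factors n)"

definition ell :: "nat \<Rightarrow> nat \<Rightarrow> nat" where
  "ell k m = card {xs :: nat list. length xs = k \<and> Lcm (set xs) = m}"

definition new_primes :: "(nat \<Rightarrow> real) \<Rightarrow> nat \<Rightarrow> nat set" where
  "new_primes P i = {p. prime p \<and> P i < real p \<and> real p \<le> P (Suc i)}"

context
  fixes Ms :: "nat set"        \<comment> \<open>the moduli\<close>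
    and a :: "nat \<Rightarrow> int"      \<comment> \<open>the residue attached to each modulus\<close>
    and P :: "nat \<Rightarrow> real"     \<comment> \<open>the thresholds \<open>P\<^sub>0 < P\<^sub>1 < \<dots>\<close>\<close>
    and lam :: real
begin

definition v :: "nat \<Rightarrow> nat" where
  "v p = multiplicity p (Lcm Ms)"

definition Q :: "nat \<Rightarrow> nat" where
  "Q i = (\<Prod>p | prime p \<and> real p \<le> P i. p ^ v p)"

definition moduli :: "nat \<Rightarrow> nat set" where
  "moduli i = {m \<in> Ms. m dvd Q i}"

definition R :: "nat \<Rightarrow> int set" where
  "R i = (\<Inter>m \<in> moduli i. - res_class (a m) m)"

text \<open>\<open>new_moduli i\<close> is the set \<open>\<N>\<^sub>i\<^sub>+\<^sub>1\<close> and \<open>new_set i n r\<close> is the set \<open>A\<^sub>n\<^sub>,\<^sub>r\<close> at stage \<open>i\<close>.\<close>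

definition new_moduli :: "nat \<Rightarrow> nat set" where
  "new_moduli i = {n. n dvd Q (Suc i) \<and> n > 1 \<and>
     (\<forall>p. prime p \<and> p dvd n \<longrightarrow> P i < real p \<and> real p \<le> P (Suc i))}"

definition new_set :: "nat \<Rightarrow> nat \<Rightarrow> int \<Rightarrow> int set" where
  "new_set i n r = res_class r (Q i) \<inter>
     (\<Union>m0 \<in> {m0. m0 dvd Q i \<and> m0 * n \<in> moduli (Suc i)}. res_class (a (m0 * n)) (m0 * n))"

definition good :: "nat \<Rightarrow> int \<Rightarrow> bool" where
  "good i r \<longleftrightarrow> (\<forall>p \<in> new_primes P i.
     (\<Sum>n | n \<in> new_moduli i \<and> p dvd n.
        real (num_classes (n * Q i) (new_set i n r)) * exp (lam * real (omega n)) / real n)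
     \<le> 1 - exp (- lam))"

text \<open>The index is shifted by one: \<open>Rstar_pred i\<close> is \<open>R\<^sup>*\<close> at index \<open>i - 1\<close>, so that the recursion
  starts from \<open>R\<^sup>*\<close> at index \<open>-1\<close>, which is the set of all integers.\<close>

primrec Rstar_pred :: "nat \<Rightarrow> int set" where
  "Rstar_pred 0 = UNIV"
| "Rstar_pred (Suc i) = (\<Union>r \<in> {r. r \<in> Rstar_pred i \<inter> R i \<and> good i r}. res_class r (Q i))"

definition Rstar :: "nat \<Rightarrow> int set" where
  "Rstar i = Rstar_pred (Suc i)"

text \<open>\<open>mu i r\<close> is the mass of the class of \<open>r\<close> modulo \<open>Q i\<close>.\<close>

primrec mu :: "nat \<Rightarrow> int \<Rightarrow> real" where
  "mu 0 r = (if r \<in> R 0 then 1 / real (num_classes (Q 0) (R 0)) else 0)"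
| "mu (Suc i) r =
     (if r \<in> Rstar i \<inter> R (Suc i)
      then mu i (r mod int (Q i)) /
           real (num_classes (Q (Suc i)) (R (Suc i) \<inter> res_class r (Q i)))
      else 0)"

definition mu_set :: "nat \<Rightarrow> int set \<Rightarrow> real" where
  "mu_set i S = (\<Sum>r \<in> classes_mod (Q i) S. mu i r)"

definition bias :: "nat \<Rightarrow> nat \<Rightarrow> real" where
  "bias k i = root k (\<Sum>m | m dvd Q i. real (ell k m) *
     (MAX b \<in> {0..<int m}.
        mu_set i (Rstar_pred i \<inter> R i \<inter> res_class b m) / mu_set i (Rstar_pred i \<inter> R i)))"

definition fibre_density :: "nat \<Rightarrow> int \<Rightarrow> real" where
  "fibre_density i r =
     real (num_classes (Q (Suc i)) (R (Suc i) \<inter> res_class r (Q i))) /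
     real (num_classes (Q (Suc i)) (res_class r (Q i)))"

end

end

theory Submission
  imports Defs
begin

text \<open>
  Write \<open>Q\<^sub>i\<^sub>+\<^sub>1 = W Q\<^sub>i\<close> with \<open>W\<close> a product of powers of the new primes, coprime to \<open>Q\<^sub>i\<close>. On the fibre above
  a class \<open>r mod Q\<^sub>i\<close>, the sets \<open>A\<^sub>n\<^sub>,\<^sub>r\<close> are events of the uniform measure on \<open>\<int>/W\<close> and, by the Chinese remainder
  theorem, events attached to coprime \<open>n\<close> are independent. Goodness of \<open>r\<close> is a Lovasz local lemma
  condition: removing the events that involve one further prime costs a factor at most \<open>exp \<lambda>\<close>. Hence
  the surviving part of the fibre is non-empty, and a class \<open>b mod n\<close> takes up a fraction at
  most \<open>exp (\<lambda> \<omega>(n)) / n\<close> of it. Summing this over the divisors of \<open>Q\<^sub>i\<^sub>+\<^sub>1\<close> bounds the new bias statistics,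
  because \<open>\<ell>\<^sub>k\<close> is multiplicative.

  The mass of the classes that are not good is bounded by Markov's inequality for \<open>k\<close>th
  moments. Expanding the moment gives \<open>k\<close>-tuples of congruences to divisors of \<open>Q\<^sub>i\<close>, i.e. one congruence
  to their lcm, and these tuples are exactly what \<open>\<beta>\<^sub>k\<^sup>k\<close> counts.
\<close>

section \<open>Densities of periodic sets\<close>

definition periodic :: "nat \<Rightarrow> int set \<Rightarrow> bool" where
  "periodic q S \<longleftrightarrow> (\<forall>x y. [x = y] (mod int q) \<longrightarrow> (x \<in> S \<longleftrightarrow> y \<in> S))"

lemma periodicD: "periodic q S \<Longrightarrow> [x = y] (mod int q) \<Longrightarrow> x \<in> S \<longleftrightarrow> y \<in> S"
  by (auto simp: periodic_def)

lemma periodic_dvd: "periodic m S \<Longrightarrow> m dvd n \<Longrightarrow> periodic n S"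
  unfolding periodic_def by (meson cong_dvd_modulus int_dvd_int_iff)

lemma periodic_UNIV: "periodic q UNIV"
  by (simp add: periodic_def)

lemma periodic_Int: "periodic q S \<Longrightarrow> periodic q T \<Longrightarrow> periodic q (S \<inter> T)"
  by (auto simp: periodic_def)

lemma periodic_Compl: "periodic q S \<Longrightarrow> periodic q (- S)"
  by (auto simp: periodic_def)

lemma periodic_UN: "(\<And>i. i \<in> I \<Longrightarrow> periodic q (S i)) \<Longrightarrow> periodic q (\<Union>i\<in>I. S i)"
  unfolding periodic_def by blast

lemma periodic_INT: "(\<And>i. i \<in> I \<Longrightarrow> periodic q (S i)) \<Longrightarrow> periodic q (\<Inter>i\<in>I. S i)"
  unfolding periodic_def by blast

lemma periodic_res_class: "periodic m (res_class b m)"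
  unfolding periodic_def res_class_def by (auto intro: cong_trans cong_sym)

lemma res_class_cong: "[x = y] (mod int q) \<Longrightarrow> res_class x q = res_class y q"
  unfolding res_class_def by (auto intro: cong_trans cong_sym)

lemma res_class_mod: "res_class (x mod int q) q = res_class x q"
  by (rule res_class_cong) (simp add: cong_def)

lemma mem_res_class_self: "x \<in> res_class x q"
  by (simp add: res_class_def)

lemma classes_mod_subset: "q > 0 \<Longrightarrow> classes_mod q S \<subseteq> {0..<int q}"
  by (auto simp: classes_mod_def)

lemma finite_classes_mod: "q > 0 \<Longrightarrow> finite (classes_mod q S)"
  using classes_mod_subset finite_subset by blast

lemma classes_mod_periodic:
  assumes "q > 0" "periodic q S"
  shows "classes_mod q S = S \<inter> {0..<int q}"
proof
  show "classes_mod q S \<subseteq> S \<inter> {0..<int q}"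
  proof
    fix y assume "y \<in> classes_mod q S"
    then obtain x where x: "x \<in> S" "y = x mod int q" by (auto simp: classes_mod_def)
    have "y \<in> S" using x periodicD[OF assms(2), of x y] by (simp add: cong_def)
    then show "y \<in> S \<inter> {0..<int q}" using x assms(1) by auto
  qed
  show "S \<inter> {0..<int q} \<subseteq> classes_mod q S"
    by (force simp: classes_mod_def image_iff)
qed

text \<open>Division with remainder by \<open>n\<close>: the quotient is free among \<open>k\<close>
  values, and by periodicity only the remainder decides membership.\<close>

lemma num_classes_periodic_mult:
  assumes "n > 0" "k > 0" "periodic n S"
  shows "num_classes (k * n) S = k * num_classes n S"
proof -
  have per: "periodic (k * n) S" using assms(3) by (rule periodic_dvd) simp
  have "bij_betw (\<lambda>x. (x div int n, x mod int n)) (S \<inter> {0..<int (k * n)})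
      ({0..<int k} \<times> (S \<inter> {0..<int n}))"
  proof (rule bij_betw_byWitness[where f' = "\<lambda>(q, s). q * int n + s"])
    show "(\<lambda>x. (x div int n, x mod int n)) ` (S \<inter> {0..<int (k * n)})
        \<subseteq> {0..<int k} \<times> (S \<inter> {0..<int n})"
    proof clarify
      fix x assume x: "x \<in> S" "x \<in> {0..<int (k * n)}"
      have "x div int n < int k"
      proof (rule ccontr)
        assume "\<not> x div int n < int k"
        then have "int k * int n \<le> x div int n * int n" by (intro mult_right_mono) auto
        also have "\<dots> \<le> x"
          using div_mult_mod_eq[of x "int n"] pos_mod_sign[of "int n" x] assms(1) by linarith
        finally show False using x by simp
      qed
      moreover have "x mod int n \<in> S"
        using periodicD[OF assms(3), of x "x mod int n"] x by (simp add: cong_def)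
      ultimately show "x div int n \<in> {0..<int k} \<and> x mod int n \<in> S \<inter> {0..<int n}"
        using x assms by (auto simp: pos_imp_zdiv_nonneg_iff)
    qed
    show "(\<lambda>(q, s). q * int n + s) ` ({0..<int k} \<times> (S \<inter> {0..<int n})) \<subseteq> S \<inter> {0..<int (k * n)}"
    proof clarify
      fix q s assume q: "q \<in> {0..<int k}" and s: "s \<in> S" "s \<in> {0..<int n}"
      have "q * int n + s \<in> S"
        using periodicD[OF assms(3), of s "q * int n + s"] s by (simp add: cong_def)
      moreover have "q * int n + s < int k * int n"
      proof -
        have "(q + 1) * int n \<le> int k * int n" using q by (intro mult_right_mono) auto
        then show ?thesis using s by (simp add: algebra_simps)
      qed
      ultimately show "q * int n + s \<in> S \<inter> {0..<int (k * n)}" using q s by auto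
    qed
  qed (auto simp: assms)
  then have "card (S \<inter> {0..<int (k * n)}) = k * card (S \<inter> {0..<int n})"
    by (auto dest: bij_betw_same_card simp: card_cartesian_product)
  then show ?thesis
    using assms per by (simp add: num_classes_def classes_mod_periodic)
qed

text \<open>Chinese remainder theorem: a residue modulo \<open>m * n\<close> is an arbitrary pair of
  residues modulo \<open>m\<close> and \<open>n\<close>, and each set constrains only one of the
  two. This is the source of all independence below.\<close>

lemma num_classes_coprime_Int:
  assumes "m > 0" "n > 0" "coprime m n" "periodic m S" "periodic n T"
  shows "num_classes (m * n) (S \<inter> T) = num_classes m S * num_classes n T"
proof -
  have per: "periodic (m * n) (S \<inter> T)"
    using assms by (intro periodic_Int periodic_dvd[OF assms(4)] periodic_dvd[OF assms(5)]) auto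
  have "bij_betw (\<lambda>x. (x mod int m, x mod int n)) (S \<inter> T \<inter> {0..<int (m * n)})
      ((S \<inter> {0..<int m}) \<times> (T \<inter> {0..<int n}))"
    unfolding bij_betw_def
  proof
    show "inj_on (\<lambda>x. (x mod int m, x mod int n)) (S \<inter> T \<inter> {0..<int (m * n)})"
    proof (rule inj_onI)
      fix x y
      assume xy: "x \<in> S \<inter> T \<inter> {0..<int (m * n)}" "y \<in> S \<inter> T \<inter> {0..<int (m * n)}"
        "(x mod int m, x mod int n) = (y mod int m, y mod int n)"
      then have "[x = y] (mod int m)" "[x = y] (mod int n)" by (auto simp: cong_def)
      then have "[x = y] (mod int m * int n)"
        using assms(3) by (intro coprime_cong_mult) auto
      then show "x = y" using xy by (auto simp: cong_def)
    qed
    show "(\<lambda>x. (x mod int m, x mod int n)) ` (S \<inter> T \<inter> {0..<int (m * n)})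
        = (S \<inter> {0..<int m}) \<times> (T \<inter> {0..<int n})" (is "?f ` ?A = ?B")
    proof
      show "?f ` ?A \<subseteq> ?B"
      proof clarify
        fix x assume x: "x \<in> S" "x \<in> T"
        have "x mod int m \<in> S" "x mod int n \<in> T"
          using x periodicD[OF assms(4), of x "x mod int m"] periodicD[OF assms(5), of x "x mod int n"]
          by (auto simp: cong_def)
        then show "x mod int m \<in> S \<inter> {0..<int m} \<and> x mod int n \<in> T \<inter> {0..<int n}"
          using assms by auto
      qed
      show "?B \<subseteq> ?f ` ?A"
      proof clarify
        fix s t assume st: "s \<in> S" "s \<in> {0..<int m}" "t \<in> T" "t \<in> {0..<int n}"
        obtain x where x: "[x = s] (mod int m)" "[x = t] (mod int n)"
          using binary_chinese_remainder_int[of "int m" "int n" s t] assms(3) by auto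
        define y where "y = x mod (int m * int n)"
        have yx: "[y = x] (mod int m)" "[y = x] (mod int n)"
          unfolding y_def
          by (metis cong_modulus_mult cong_def mod_mod_trivial)
             (metis cong_modulus_mult cong_def mod_mod_trivial mult.commute)
        have ys: "[y = s] (mod int m)" "[y = t] (mod int n)"
          using x yx cong_trans by blast+
        have "y \<in> S" "y \<in> T"
          using periodicD[OF assms(4) ys(1)] periodicD[OF assms(5) ys(2)] st by auto
        moreover have "y \<in> {0..<int (m * n)}" unfolding y_def using assms by auto
        moreover have "?f y = (s, t)" using ys st by (auto simp: cong_def)
        ultimately show "(s, t) \<in> ?f ` ?A" by (intro image_eqI[of _ _ y]) simp_all
      qed
    qed
  qed
  then have "card (S \<inter> T \<inter> {0..<int (m * n)}) = card (S \<inter> {0..<int m}) * card (T \<inter> {0..<int n})"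
    by (auto dest: bij_betw_same_card simp: card_cartesian_product)
  then show ?thesis
    using assms per by (simp add: num_classes_def classes_mod_periodic)
qed

text \<open>The fibre above \<open>r mod q\<close> is parametrised by x = r + q t. Classes modulo
  \<open>n * q\<close> in the fibre correspond to classes of t modulo \<open>n\<close>; no
  coprimality of \<open>n\<close> and \<open>q\<close> enters.\<close>

lemma num_classes_fibre:
  assumes "q > 0" "n > 0" "periodic (n * q) S" "S \<subseteq> res_class r q"
  shows "num_classes (n * q) S = num_classes n {t. r + int q * t \<in> S}"
    and "periodic n {t. r + int q * t \<in> S}"
proof -
  have shift: "[r + int q * s = r + int q * t] (mod int (n * q)) \<longleftrightarrow> [s = t] (mod int n)" for s t
  proof -
    have "r + int q * s - (r + int q * t) = (s - t) * int q" by (simp add: algebra_simps)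
    then show ?thesis using assms(1) by (simp add: cong_iff_dvd_diff)
  qed
  show per: "periodic n {t. r + int q * t \<in> S}"
    unfolding periodic_def using periodicD[OF assms(3)] shift by blast
  let ?f = "\<lambda>t. (r + int q * t) mod int (n * q)"
  let ?A = "{t. r + int q * t \<in> S} \<inter> {0..<int n}"
  have "inj_on ?f ?A"
  proof (rule inj_onI)
    fix s t assume st: "s \<in> ?A" "t \<in> ?A" "?f s = ?f t"
    then have "[s = t] (mod int n)" using shift[of s t] by (simp add: cong_def)
    then show "s = t" using st by (simp add: cong_def)
  qed
  moreover have "?f ` ?A = classes_mod (n * q) S"
  proof
    show "?f ` ?A \<subseteq> classes_mod (n * q) S" by (auto simp: classes_mod_def)
    show "classes_mod (n * q) S \<subseteq> ?f ` ?A"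
    proof
      fix y assume "y \<in> classes_mod (n * q) S"
      then obtain x where x: "x \<in> S" "y = x mod int (n * q)" by (auto simp: classes_mod_def)
      have "[x = r] (mod int q)" using x assms(4) by (auto simp: res_class_def)
      then obtain u where u: "x = r + int q * u"
        by (metis cong_iff_lin cong_sym)
      have c: "[r + int q * u = r + int q * (u mod int n)] (mod int (n * q))"
        unfolding shift by (simp add: cong_def)
      have "u mod int n \<in> ?A"
        using periodicD[OF assms(3) c] x u assms(2) by auto
      moreover have "?f (u mod int n) = y" using c u x by (simp add: cong_def)
      ultimately show "y \<in> ?f ` ?A" by blast
    qed
  qed
  ultimately have "card ?A = card (classes_mod (n * q) S)" by (metis card_image)
  then show "num_classes (n * q) S = num_classes n {t. r + int q * t \<in> S}"
    using per assms(2) by (simp add: num_classes_def classes_mod_periodic)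
qed

section \<open>Density as the uniform probability measure on Z/q\<close>

definition density :: "nat \<Rightarrow> int set \<Rightarrow> real" where
  "density q S = real (num_classes q S) / real q"

lemma density_nonneg: "density q S \<ge> 0"
  by (simp add: density_def)

lemma density_mono: "q > 0 \<Longrightarrow> S \<subseteq> T \<Longrightarrow> density q S \<le> density q T"
  unfolding density_def num_classes_def
  by (intro divide_right_mono of_nat_mono card_mono finite_classes_mod) (auto simp: classes_mod_def)

lemma density_Un_le: "density q (S \<union> T) \<le> density q S + density q T"
proof -
  have "num_classes q (S \<union> T) \<le> num_classes q S + num_classes q T"
    unfolding num_classes_def classes_mod_def image_Un by (rule card_Un_le)
  then show ?thesis
    unfolding density_def by (metis add_divide_distrib divide_right_mono of_nat_0_le_iff of_nat_add of_nat_mono)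
qed

lemma density_UN_le:
  assumes "finite I"
  shows "density q (\<Union>i\<in>I. S i) \<le> (\<Sum>i\<in>I. density q (S i))"
  using assms
proof (induction I rule: finite_induct)
  case empty
  then show ?case by (simp add: density_def num_classes_def classes_mod_def)
next
  case (insert j I)
  then show ?case using density_Un_le[of q "S j" "\<Union>i\<in>I. S i"] by simp
qed

lemma density_UNIV: "q > 0 \<Longrightarrow> density q UNIV = 1"
  by (simp add: density_def num_classes_def classes_mod_periodic[OF _ periodic_UNIV])

text \<open>Densities of sets with different periods can thus all be compared at one common modulus
  \<open>w\<close>.\<close>

lemma density_dvd:
  assumes "periodic n S" "n dvd w" "w > 0"
  shows "density w S = density n S"
proof -
  obtain k where k: "w = k * n" using assms(2) by (metis dvd_def mult.commute)
  then have "n > 0" "k > 0" using assms(3) by auto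
  then show ?thesis
    using num_classes_periodic_mult[of n k S] assms k by (simp add: density_def)
qed

text \<open>Independence of events attached to coprime moduli, in the form that the local lemma
  uses.\<close>

lemma density_Int_coprime:
  assumes "periodic m S" "periodic n T" "coprime m n" "m * n dvd w" "w > 0"
  shows "density w (S \<inter> T) = density w S * density w T"
proof -
  have pos: "m > 0" "n > 0" using assms(4,5) by (auto intro: Nat.gr0I)
  have per: "periodic (m * n) (S \<inter> T)"
    by (intro periodic_Int periodic_dvd[OF assms(1)] periodic_dvd[OF assms(2)]) auto
  have "density w (S \<inter> T) = density (m * n) (S \<inter> T)"
    by (rule density_dvd[OF per assms(4,5)])
  also have "\<dots> = density m S * density n T"
    using num_classes_coprime_Int[OF pos assms(3,1,2)] by (simp add: density_def)
  also have "\<dots> = density w S * density w T"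
    using assms density_dvd[of m S w] density_dvd[of n T w]
    by (metis dvd_mult_left dvd_mult_right)
  finally show ?thesis .
qed

lemma density_res_class:
  assumes "d dvd w" "w > 0"
  shows "density w (res_class c d) = 1 / real d"
proof -
  have "d > 0" using assms by (auto intro: Nat.gr0I)
  have "classes_mod d (res_class c d) = {c mod int d}"
    by (auto simp: classes_mod_def res_class_def cong_def image_iff intro!: exI[of _ c])
  then show ?thesis
    using density_dvd[OF periodic_res_class assms] by (simp add: density_def num_classes_def)
qed

section \<open>The local lemma\<close>

text \<open>The local lemma stripped of probability. \<open>f S\<close> stands for the probability
  of avoiding every event whose support lies in \<open>S\<close>; \<open>step\<close> is a union
  bound over the events that become relevant when \<open>p\<close> is added, each being independent
  of the events supported off \<open>supp n\<close>.\<close>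

lemma lovasz_local_numeric:
  fixes f :: "'p set \<Rightarrow> real" and w :: "'n \<Rightarrow> real" and supp :: "'n \<Rightarrow> 'p set"
  assumes fin: "finite G" "finite N" "\<And>n. n \<in> N \<Longrightarrow> finite (supp n)" and lam: "lam \<ge> 0"
    and w: "\<And>n. n \<in> N \<Longrightarrow> 0 \<le> w n" and f: "\<And>S. 0 \<le> f S"
    and step: "\<And>S p. S \<subseteq> G \<Longrightarrow> p \<in> G - S \<Longrightarrow>
      f S \<le> f (insert p S) + (\<Sum>n | n \<in> N \<and> p \<in> supp n. w n * f (S - supp n))"
    and good: "\<And>p. p \<in> G \<Longrightarrow>
      (\<Sum>n | n \<in> N \<and> p \<in> supp n. w n * exp (lam * real (card (supp n)))) \<le> 1 - exp (- lam)"
    and T: "T \<subseteq> G" "S \<subseteq> T"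
  shows "f S \<le> exp (lam * real (card (T - S))) * f T"
  using T
proof (induction "card T" arbitrary: S T rule: less_induct)
  case less
  show ?case
  proof (cases "S = T")
    case False
    then obtain p where p: "p \<in> T" "p \<notin> S" using less.prems by auto
    \<comment> \<open>One element outside \<open>S\<close> is removed from \<open>T\<close>. The
      induction hypothesis for \<open>T'\<close> is used twice: for the sets
      \<open>T' - supp n\<close> in the loss term, and for \<open>S\<close> itself.\<close>
    define T' where "T' = T - {p}"
    have finT: "finite T" using less.prems fin finite_subset by blast
    have T': "card T' < card T" "T' \<subseteq> G" "S \<subseteq> T'" "T = insert p T'" "p \<in> G - T'"
      using p less.prems finT card_Diff1_less[of T p] by (auto simp: T'_def)
    have "f T' \<le> f T + (\<Sum>n | n \<in> N \<and> p \<in> supp n. w n * f (T' - supp n))"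
      using step[OF T'(2,5)] T'(4) by simp
    also have "(\<Sum>n | n \<in> N \<and> p \<in> supp n. w n * f (T' - supp n))
        \<le> (\<Sum>n | n \<in> N \<and> p \<in> supp n. w n * exp (lam * real (card (supp n))) * f T')"
    proof (rule sum_mono)
      fix n assume n: "n \<in> {n. n \<in> N \<and> p \<in> supp n}"
      have "card (T' - (T' - supp n)) \<le> card (supp n)"
        using n fin by (intro card_mono) auto
      then have "exp (lam * real (card (T' - (T' - supp n)))) * f T'
          \<le> exp (lam * real (card (supp n))) * f T'"
        using lam f by (intro mult_right_mono) (auto intro: mult_left_mono)
      moreover have "f (T' - supp n) \<le> exp (lam * real (card (T' - (T' - supp n)))) * f T'"
        by (rule less.hyps) (use T' in auto)
      ultimately have "f (T' - supp n) \<le> exp (lam * real (card (supp n))) * f T'" by linarith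
      then show "w n * f (T' - supp n) \<le> w n * exp (lam * real (card (supp n))) * f T'"
        using w n by (simp add: mult.assoc mult_left_mono)
    qed
    also have "\<dots> \<le> (1 - exp (- lam)) * f T'"
      using good[of p] T' f by (auto simp flip: sum_distrib_right intro!: mult_right_mono)
    \<comment> \<open>The threshold 1 - exp (- lam) in \<open>good\<close> is chosen so that one
      further element costs a factor of at most exp lam.\<close>
    finally have "exp (- lam) * f T' \<le> f T" by (simp add: algebra_simps)
    then have *: "f T' \<le> exp lam * f T" by (simp add: exp_minus field_simps)
    have card: "card (T - S) = Suc (card (T' - S))"
    proof -
      have "T - S = insert p (T' - S)" "p \<notin> T' - S" using p by (auto simp: T'_def)
      moreover have "finite (T' - S)" using finT by (simp add: T'_def)
      ultimately show ?thesis by simp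
    qed
    have "f S \<le> exp (lam * real (card (T' - S))) * f T'"
      by (rule less.hyps) (use T' in auto)
    also have "\<dots> \<le> exp (lam * real (card (T' - S))) * (exp lam * f T)"
      using * by (intro mult_left_mono) auto
    also have "\<dots> = exp (lam * real (card (T - S))) * f T"
      by (simp add: card algebra_simps exp_add)
    finally show ?thesis .
  qed simp
qed

lemma coprime_prod_prime_powers:
  fixes v :: "nat \<Rightarrow> nat"
  assumes "finite G" "\<And>p. p \<in> G \<Longrightarrow> prime p" "n > 0" "prime_factors n \<inter> G = {}"
  shows "coprime n (\<Prod>p\<in>G. p ^ v p)"
proof (rule prod_coprime_right)
  fix p assume "p \<in> G"
  then have "prime p" "\<not> p dvd n" using assms by (auto simp: prime_factors_dvd)
  then have "coprime p n" by (simp add: prime_imp_coprime)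
  then show "coprime n (p ^ v p)" by (simp add: ac_simps)
qed

lemma prime_factors_dvd_prod_prime_powers:
  fixes v :: "nat \<Rightarrow> nat"
  assumes "finite G" "\<And>p. p \<in> G \<Longrightarrow> prime p" "n dvd (\<Prod>p\<in>G. p ^ v p)"
  shows "prime_factors n \<subseteq> G"
proof
  fix p assume "p \<in> prime_factors n"
  then have p: "prime p" "p dvd (\<Prod>p\<in>G. p ^ v p)" using assms(3) by (auto intro: dvd_trans)
  then obtain q where q: "q \<in> G" "p dvd q ^ v q"
    by (auto simp: prime_dvd_prod_iff[OF assms(1)])
  then have "p dvd q" using p(1) prime_dvd_power by blast
  then show "p \<in> G" using q(1) p(1) assms(2) primes_dvd_imp_eq by blast
qed

text \<open>The local lemma with primes as coordinates of Z/W and the event \<open>E n\<close>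
  supported on the prime factors of \<open>n\<close>.\<close>

lemma local_lemma_prime_powers:
  fixes G :: "nat set" and v :: "nat \<Rightarrow> nat" and E :: "nat \<Rightarrow> int set"
  assumes W_def: "W = (\<Prod>p\<in>G. p ^ v p)"
    and N_def: "N = {n. n dvd W \<and> n > 1}"
    and U_def: "U = {t. \<forall>n\<in>N. t \<notin> E n}"
    and G: "finite G" "\<And>p. p \<in> G \<Longrightarrow> prime p" and lam: "lam \<ge> 0"
    and per: "\<And>n. n \<in> N \<Longrightarrow> periodic n (E n)"
    and good: "\<And>p. p \<in> G \<Longrightarrow> (\<Sum>n | n \<in> N \<and> p dvd n.
      real (num_classes n (E n)) * exp (lam * real (omega n)) / real n) \<le> 1 - exp (- lam)"
  shows "density W U > 0"
    and "\<And>d c. d dvd W \<Longrightarrow>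
      density W (U \<inter> res_class c d) \<le> exp (lam * real (omega d)) / real d * density W U"
proof -
  \<comment> \<open>\<open>part S\<close> is the factor of \<open>W\<close> supported on
    \<open>S\<close>, and a period of \<open>A S\<close>, the set avoiding all events supported in
    \<open>S\<close>.\<close>
  define part where "part S = (\<Prod>p\<in>S. p ^ v p)" for S
  define A where "A S = {t. \<forall>n\<in>N. prime_factors n \<subseteq> S \<longrightarrow> t \<notin> E n}" for S
  have W0: "W > 0" unfolding W_def using G by (auto intro!: prod_pos simp: prime_gt_0_nat)
  have finN: "finite N"
    by (rule finite_subset[of _ "{..W}"]) (use W0 in \<open>auto simp: N_def intro: dvd_imp_le\<close>)
  have Wpart: "W = part S * part (G - S)" if "S \<subseteq> G" for S
    unfolding W_def part_def using prod.subset_diff[OF that G(1), of "\<lambda>p. p ^ v p"]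
    by (simp add: mult.commute)
  have pfG: "prime_factors n \<subseteq> G" if "n dvd W" for n
    using prime_factors_dvd_prod_prime_powers[OF G] that by (simp add: W_def)
  have dvd_part: "n dvd part S" if "n dvd W" "S \<subseteq> G" "prime_factors n \<subseteq> S" for n S
  proof -
    have "n > 0" using that W0 by (auto intro: Nat.gr0I)
    \<comment> \<open>In \<open>W = part S * part (G - S)\<close> the second factor shares no prime
      with \<open>n\<close>, so it can be cancelled.\<close>
    then have "coprime n (part (G - S))"
      unfolding part_def using that G by (intro coprime_prod_prime_powers) auto
    then show ?thesis using that Wpart[of S] by (simp add: coprime_dvd_mult_left_iff)
  qed
  have perA: "periodic (part S) (A S)" if "S \<subseteq> G" for S
  proof -
    have "periodic (part S) (\<Inter>n\<in>{n\<in>N. prime_factors n \<subseteq> S}. - E n)"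
    proof (intro periodic_INT periodic_Compl)
      fix n assume "n \<in> {n\<in>N. prime_factors n \<subseteq> S}"
      then show "periodic (part S) (E n)"
        using dvd_part that by (auto simp: N_def intro!: periodic_dvd[OF per])
    qed
    moreover have "(\<Inter>n\<in>{n\<in>N. prime_factors n \<subseteq> S}. - E n) = A S" by (auto simp: A_def)
    ultimately show ?thesis by simp
  qed
  have indep: "density W (X \<inter> A (S - prime_factors d)) = density W X * density W (A (S - prime_factors d))"
    if "d dvd W" "periodic d X" "S \<subseteq> G" for d X S
  proof (rule density_Int_coprime[OF that(2) perA])
    have d0: "d > 0" using that W0 by (auto intro: Nat.gr0I)
    show "S - prime_factors d \<subseteq> G" using that by auto
    show cop: "coprime d (part (S - prime_factors d))"
      unfolding part_def using that G d0 finite_subset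
      by (intro coprime_prod_prime_powers) (auto intro: finite_subset)
    have "part (S - prime_factors d) dvd W"
      using Wpart[of "S - prime_factors d"] that(3) by (metis Diff_subset dvd_triv_left subset_trans)
    then show "d * part (S - prime_factors d) dvd W"
      using cop that divides_mult by blast
  qed (rule W0)
  have mono: "density W (A T) \<le> density W (A S)" if "S \<subseteq> T" for S T
    using that by (intro density_mono W0) (auto simp: A_def)
  have main: "density W (A S) \<le> exp (lam * real (card (G - S))) * density W (A G)" if "S \<subseteq> G" for S
  proof (rule lovasz_local_numeric[where f = "\<lambda>S. density W (A S)" and supp = prime_factors
        and N = N and w = "\<lambda>n. density n (E n)"])
    fix S p assume S: "S \<subseteq> G" and p: "p \<in> G - S"
    let ?N = "{n. n \<in> N \<and> p \<in> prime_factors n}"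
    \<comment> \<open>A point lost on adding \<open>p\<close> lies in some \<open>E n\<close> whose
      support contains \<open>p\<close>; it still avoids every event supported in \<open>S\<close>
      and off the primes of \<open>n\<close>.\<close>
    have "A S \<subseteq> A (insert p S) \<union> (\<Union>n\<in>?N. E n \<inter> A (S - prime_factors n))"
    proof
      fix t assume t: "t \<in> A S"
      show "t \<in> A (insert p S) \<union> (\<Union>n\<in>?N. E n \<inter> A (S - prime_factors n))"
      proof (cases "t \<in> A (insert p S)")
        case False
        then obtain n where n: "n \<in> N" "prime_factors n \<subseteq> insert p S" "t \<in> E n"
          by (auto simp: A_def)
        then have "p \<in> prime_factors n" using t by (auto simp: A_def)
        moreover have "t \<in> A (S - prime_factors n)" using t by (auto simp: A_def)
        ultimately show ?thesis using n by auto
      qed simp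
    qed
    then have "density W (A S) \<le> density W (A (insert p S) \<union> (\<Union>n\<in>?N. E n \<inter> A (S - prime_factors n)))"
      by (rule density_mono[OF W0])
    also have "\<dots> \<le> density W (A (insert p S)) + density W (\<Union>n\<in>?N. E n \<inter> A (S - prime_factors n))"
      by (rule density_Un_le)
    also have "density W (\<Union>n\<in>?N. E n \<inter> A (S - prime_factors n))
        \<le> (\<Sum>n\<in>?N. density W (E n \<inter> A (S - prime_factors n)))"
      using finN by (intro density_UN_le) auto
    also have "\<dots> = (\<Sum>n\<in>?N. density n (E n) * density W (A (S - prime_factors n)))"
    proof (rule sum.cong[OF refl])
      fix n assume n: "n \<in> ?N"
      then have "density W (E n) = density n (E n)"
        using per W0 by (intro density_dvd) (auto simp: N_def)
      then show "density W (E n \<inter> A (S - prime_factors n))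
          = density n (E n) * density W (A (S - prime_factors n))"
        using indep[of n "E n" S] n per S by (auto simp: N_def)
    qed
    finally show "density W (A S) \<le> density W (A (insert p S)) +
        (\<Sum>n\<in>?N. density n (E n) * density W (A (S - prime_factors n)))" by simp
  next
    fix p assume p: "p \<in> G"
    have "{n. n \<in> N \<and> p \<in> prime_factors n} = {n. n \<in> N \<and> p dvd n}"
      using G(2)[OF p] by (auto simp: N_def prime_factors_dvd)
    then show "(\<Sum>n | n \<in> N \<and> p \<in> prime_factors n.
        density n (E n) * exp (lam * real (card (prime_factors n)))) \<le> 1 - exp (- lam)"
      using good[OF p] by (simp add: density_def omega_def)
  qed (use that G finN lam in \<open>auto simp: density_nonneg\<close>)
  have UA: "U = A G" using pfG by (auto simp: U_def A_def N_def)
  \<comment> \<open>Every n > 1 has a prime factor, so no event has empty support. Comparing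
    \<open>A {}\<close> with \<open>A G\<close> therefore bounds the density of \<open>U\<close>
    away from 0.\<close>
  have "A {} = UNIV" by (auto simp: A_def N_def prime_factorization_empty_iff)
  then have "1 \<le> exp (lam * real (card G)) * density W U"
    using main[of "{}"] density_UNIV[OF W0] UA by simp
  then show "density W U > 0"
    by (metis density_nonneg less_eq_real_def mult_zero_right not_one_le_zero)
  fix d c assume d: "d dvd W"
  \<comment> \<open>Dropping all events that share a prime with \<open>d\<close> makes the rest
    independent of the class modulo \<open>d\<close>. Restoring them costs one factor exp lam per
    prime of \<open>d\<close>.\<close>
  have "density W (U \<inter> res_class c d) \<le> density W (res_class c d \<inter> A (G - prime_factors d))"
    unfolding UA by (intro density_mono W0) (auto simp: A_def)
  also have "\<dots> = 1 / real d * density W (A (G - prime_factors d))"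
    using indep[OF d periodic_res_class, of G c] density_res_class[OF d W0] by simp
  also have "\<dots> \<le> 1 / real d * (exp (lam * real (card (G - (G - prime_factors d)))) * density W U)"
    using main[of "G - prime_factors d"] UA by (intro mult_left_mono) auto
  also have "G - (G - prime_factors d) = prime_factors d" using pfG[OF d] by auto
  finally show "density W (U \<inter> res_class c d) \<le> exp (lam * real (omega d)) / real d * density W U"
    by (simp add: omega_def)
qed

section \<open>Sums over divisors\<close>

text \<open>A divisor \<open>m\<close> of \<open>a * b\<close> splits uniquely as a product of
  divisors of \<open>a\<close> and \<open>b\<close>, namely gcd m a and gcd m b.\<close>

lemma sum_divisors_coprime:
  fixes F :: "nat \<Rightarrow> 'a :: comm_monoid_add"
  assumes "coprime a b" "a > 0" "b > 0"
  shows "(\<Sum>m | m dvd a * b. F m) = (\<Sum>x | x dvd a. \<Sum>y | y dvd b. F (x * y))"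
proof -
  have gcds: "gcd (x * y) a = x \<and> gcd (x * y) b = y" if "x dvd a" "y dvd b" for x y
  proof -
    have c: "coprime a y" "coprime b x"
      using that coprime_divisors[of a a y b] coprime_divisors[of x a b b] assms(1)
      by (simp_all add: coprime_commute)
    show ?thesis
      using that gcd_mult_left_right_cancel[OF c(1), of x] gcd_mult_left_left_cancel[OF c(2), of y]
      by (simp add: gcd_proj1_if_dvd_nat)
  qed
  have "(\<Sum>x | x dvd a. \<Sum>y | y dvd b. F (x * y))
      = (\<Sum>(x, y)\<in>{x. x dvd a} \<times> {y. y dvd b}. F (x * y))"
    by (rule sum.cartesian_product)
  also have "\<dots> = (\<Sum>m | m dvd a * b. F m)"
  proof (rule sum.reindex_bij_witness[where i = "\<lambda>m. (gcd m a, gcd m b)" and j = "\<lambda>(x, y). x * y"])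
    fix m assume "m \<in> {m. m dvd a * b}"
    then obtain x y where "m = x * y" "x dvd a" "y dvd b" using division_decomp by blast
    then show "(case (gcd m a, gcd m b) of (x, y) \<Rightarrow> x * y) = m" using gcds by simp
  qed (auto simp: gcds intro: mult_dvd_mono)
  finally show ?thesis by simp
qed

lemma sum_divisors_prime_power:
  fixes F :: "nat \<Rightarrow> 'a :: comm_monoid_add"
  assumes "prime p"
  shows "(\<Sum>d | d dvd p ^ k. F d) = (\<Sum>j\<le>k. F (p ^ j))"
proof -
  have "{d. d dvd p ^ k} = (\<lambda>j. p ^ j) ` {..k}"
    using assms by (auto simp: divides_primepow_nat)
  moreover have "inj_on (\<lambda>j. p ^ j) {..k}"
    using prime_gt_1_nat[OF assms] by (auto intro!: inj_onI)
  ultimately show ?thesis by (simp add: sum.reindex)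
qed

text \<open>A finite Euler product for multiplicative \<open>F\<close>, splitting off one prime at a
  time.\<close>

lemma sum_divisors_prod_prime_powers:
  fixes F :: "nat \<Rightarrow> real" and v :: "nat \<Rightarrow> nat"
  assumes "F 1 = 1" "\<And>m n. m > 0 \<Longrightarrow> n > 0 \<Longrightarrow> coprime m n \<Longrightarrow> F (m * n) = F m * F n"
    and "finite G" "\<And>p. p \<in> G \<Longrightarrow> prime p"
  shows "(\<Sum>n | n dvd (\<Prod>p\<in>G. p ^ v p). F n) = (\<Prod>p\<in>G. \<Sum>j\<le>v p. F (p ^ j))"
  using assms(3,4)
proof (induction G rule: finite_induct)
  case empty
  then show ?case using assms(1) by simp
next
  case (insert q G)
  let ?W = "\<Prod>p\<in>G. p ^ v p"
  have pos: "q ^ v q > 0" "?W > 0" using insert.prems by (auto intro!: prod_pos simp: prime_gt_0_nat)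
  have cop: "coprime (q ^ v q) ?W"
  proof (rule prod_coprime_right)
    fix p assume "p \<in> G"
    then have "coprime q p" using insert by (intro primes_coprime) auto
    then show "coprime (q ^ v q) (p ^ v p)" by simp
  qed
  have "(\<Sum>n | n dvd (\<Prod>p\<in>insert q G. p ^ v p). F n)
      = (\<Sum>x | x dvd q ^ v q. \<Sum>y | y dvd ?W. F (x * y))"
    using insert.hyps sum_divisors_coprime[OF cop pos, of F] by simp
  also have "\<dots> = (\<Sum>x | x dvd q ^ v q. \<Sum>y | y dvd ?W. F x * F y)"
  proof (intro sum.cong refl assms(2))
    fix x y assume "x \<in> {x. x dvd q ^ v q}" "y \<in> {y. y dvd ?W}"
    then show "x > 0" "y > 0" "coprime x y"
      using pos cop coprime_divisors[of x "q ^ v q" y ?W] by (auto intro!: Nat.gr0I)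
  qed
  also have "\<dots> = (\<Sum>x | x dvd q ^ v q. F x) * (\<Sum>y | y dvd ?W. F y)"
    by (simp add: sum_product)
  also have "\<dots> = (\<Prod>p\<in>insert q G. \<Sum>j\<le>v p. F (p ^ j))"
    using insert by (simp add: sum_divisors_prime_power)
  finally show ?case .
qed

section \<open>The function \<open>ell k\<close>, counting \<open>k\<close>-tuples with a given
  lcm\<close>

lemma sum_lists_Lcm:
  fixes K :: "nat \<Rightarrow> real"
  assumes "q > 0"
  shows "(\<Sum>xs | set xs \<subseteq> {d. d dvd q} \<and> length xs = k. K (Lcm (set xs)))
    = (\<Sum>m | m dvd q. real (ell k m) * K m)"
proof -
  let ?X = "{xs. set xs \<subseteq> {d. d dvd q} \<and> length xs = k}"
  have fin: "finite {d. d dvd q}" using assms by (simp add: finite_divisors_nat)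
  have finX: "finite ?X" by (rule finite_lists_length_eq[OF fin])
  have "(\<Sum>xs\<in>?X. K (Lcm (set xs))) = (\<Sum>m | m dvd q. \<Sum>xs | xs \<in> ?X \<and> Lcm (set xs) = m. K (Lcm (set xs)))"
    by (rule sum.group[symmetric]) (use finX fin in \<open>auto intro!: Lcm_least\<close>)
  also have "\<dots> = (\<Sum>m | m dvd q. real (ell k m) * K m)"
  proof (rule sum.cong[OF refl])
    fix m assume "m \<in> {m. m dvd q}"
    \<comment> \<open>Entries divide their lcm, so for \<open>m\<close> dividing \<open>q\<close>
      the restriction to divisors of \<open>q\<close> is automatic and the fibre is the whole set
      counted by \<open>ell\<close>.\<close>
    then have "{xs. xs \<in> ?X \<and> Lcm (set xs) = m} = {xs. length xs = k \<and> Lcm (set xs) = m}"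
      by (auto intro: dvd_trans[OF dvd_Lcm])
    then show "(\<Sum>xs | xs \<in> ?X \<and> Lcm (set xs) = m. K (Lcm (set xs))) = real (ell k m) * K m"
      by (simp add: ell_def)
  qed
  finally show ?thesis .
qed

text \<open>Both sides count the \<open>k\<close>-tuples of divisors of \<open>q\<close>. These
  divisor sums determine \<open>ell k\<close>, so its values are read off from them below.\<close>

lemma sum_ell_divisors:
  assumes "q > 0"
  shows "(\<Sum>m | m dvd q. real (ell k m)) = real (card {d. d dvd q}) ^ k"
  using sum_lists_Lcm[OF assms, where K = "\<lambda>_. 1" and k = k]
    card_lists_length_eq[of "{d. d dvd q}" k] assms by (simp add: finite_divisors_nat)

lemma card_divisors_coprime:
  fixes a b :: nat
  assumes "coprime a b" "a > 0" "b > 0"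
  shows "card {d. d dvd a * b} = card {d. d dvd a} * card {d. d dvd b}"
  using sum_divisors_coprime[OF assms, of "\<lambda>_. 1::nat"] by simp

text \<open>Both sides have the same divisor sums, so induction on the divisors applies.\<close>

lemma ell_mult:
  assumes "coprime m n" "m > 0" "n > 0"
  shows "real (ell k (m * n)) = real (ell k m) * real (ell k n)"
  using assms
proof (induction "m * n" arbitrary: m n rule: less_induct)
  case less
  let ?A = "{x. x dvd m} \<times> {y. y dvd n}"
  let ?h = "\<lambda>(x, y). real (ell k (x * y))" and ?g = "\<lambda>(x, y). real (ell k x) * real (ell k y)"
  have fin: "finite ?A" using less.prems by (simp add: finite_divisors_nat)
  have top: "(m, n) \<in> ?A" by simp
  have "sum ?h ?A = real (card {d. d dvd m * n}) ^ k"
    using sum_divisors_coprime[OF less.prems, of "\<lambda>x. real (ell k x)"] sum_ell_divisors[of "m * n" k]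
      less.prems by (simp add: sum.cartesian_product)
  also have "\<dots> = real (card {d. d dvd m}) ^ k * real (card {d. d dvd n}) ^ k"
    using card_divisors_coprime[OF less.prems] by (simp add: power_mult_distrib)
  also have "\<dots> = sum ?g ?A"
    using sum_ell_divisors[of m k] sum_ell_divisors[of n k] less.prems
    by (simp add: sum_product sum.cartesian_product flip: sum_ell_divisors)
  finally have "sum ?h ?A = sum ?g ?A" .
  \<comment> \<open>All terms except the top one agree by induction, so equality of the two totals
    forces agreement at \<open>(m, n)\<close>.\<close>
  moreover have "sum ?h (?A - {(m, n)}) = sum ?g (?A - {(m, n)})"
  proof (rule sum.cong[OF refl])
    fix z assume z: "z \<in> ?A - {(m, n)}"
    obtain x y where zxy: "z = (x, y)" by (cases z)
    have xy: "x dvd m" "y dvd n" "x \<noteq> m \<or> y \<noteq> n" using z zxy by auto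
    have pos: "x > 0" "y > 0" using xy less.prems by (auto intro!: Nat.gr0I)
    have le: "x \<le> m" "y \<le> n" using xy less.prems by (auto intro: dvd_imp_le)
    have "x < m \<or> y < n" using xy le by auto
    then have "x * y < m * n"
      using le pos less.prems by (auto intro: mult_less_le_imp_less mult_le_less_imp_less)
    then show "?h z = ?g z"
      using less.hyps[of x y] pos xy less.prems coprime_divisors[of x m y n] zxy by simp
  qed
  ultimately show ?case
    using sum.remove[OF fin top, of ?h] sum.remove[OF fin top, of ?g] by simp
qed

lemma ell_1: "ell k 1 = 1"
  using sum_ell_divisors[of 1 k] by simp

text \<open>The divisor sums up to \<open>p ^ l\<close> are (l + 1)^k because \<open>p ^ l\<close>
  has l + 1 divisors; consecutive sums differ by the wanted value.\<close>

lemma ell_prime_power: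
  assumes "prime p" "j \<ge> 1"
  shows "real (ell k (p ^ j)) = real (j + 1) ^ k - real j ^ k"
proof -
  have S: "(\<Sum>i\<le>l. real (ell k (p ^ i))) = real (l + 1) ^ k" for l
  proof -
    have "card {d. d dvd p ^ l} = l + 1"
      using sum_divisors_prime_power[OF assms(1), of "\<lambda>_. 1::nat" l] by simp
    then show ?thesis
      using sum_ell_divisors[of "p ^ l" k] sum_divisors_prime_power[OF assms(1), of "\<lambda>x. real (ell k x)" l]
        prime_gt_0_nat[OF assms(1)] by simp
  qed
  obtain l where "j = Suc l" using assms(2) by (cases j) auto
  then show ?thesis using S[of j] S[of l] by simp
qed

section \<open>Divisor sums weighted by exp (lam omega(n)) / n\<close>

lemma sum_atMost_split_0:
  fixes f :: "nat \<Rightarrow> 'a :: comm_monoid_add"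
  shows "(\<Sum>j\<le>n. f j) = f 0 + (\<Sum>j = 1..n. f j)"
proof -
  have "{..n} = insert 0 {1..n}" by auto
  then show ?thesis by simp
qed

lemma omega_mult:
  assumes "m > 0" "n > 0" "coprime m n"
  shows "omega (m * n) = omega m + omega n"
proof -
  have "prime_factors m \<inter> prime_factors n = {}"
    using assms coprime_common_divisor not_prime_unit by (auto simp: prime_factors_dvd)
  then show ?thesis
    using assms by (simp add: omega_def prime_factors_product card_Un_disjoint)
qed

lemma omega_prime_power: "prime p \<Longrightarrow> j \<ge> 1 \<Longrightarrow> omega (p ^ j) = 1"
  by (simp add: omega_def prime_factors_power prime_prime_factors)

lemma omega_1: "omega 1 = 0"
  by (simp add: omega_def)

text \<open>The series is truncated, so the bound is strict. This strictness is what later makes up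
  for a supremum over \<open>k\<close> that is not attained.\<close>

lemma geometric_sum_less:
  fixes x :: real
  assumes "x > 1"
  shows "(\<Sum>j = 1..n. 1 / x ^ j) < 1 / (x - 1)"
proof -
  have "(x - 1) * (\<Sum>j = 1..n. 1 / x ^ j) = 1 - 1 / x ^ n"
    using assms by (induction n) (auto simp: field_simps)
  also have "\<dots> < 1" using assms by simp
  finally show ?thesis using assms by (simp add: field_simps)
qed

text \<open>The Euler product with weight \<open>h\<close>: each positive power of a prime carries
  exactly one factor exp lam. It serves for \<open>h = 1\<close> (goodness) and for
  \<open>h = ell k\<close> (bias).\<close>

lemma sum_divisors_exp_omega:
  fixes h :: "nat \<Rightarrow> real" and v :: "nat \<Rightarrow> nat"
  assumes "h 1 = 1" "\<And>m n. m > 0 \<Longrightarrow> n > 0 \<Longrightarrow> coprime m n \<Longrightarrow> h (m * n) = h m * h n"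
    and "finite G" "\<And>p. p \<in> G \<Longrightarrow> prime p"
  shows "(\<Sum>n | n dvd (\<Prod>p\<in>G. p ^ v p). h n * exp (lam * real (omega n)) / real n)
    = (\<Prod>p\<in>G. 1 + exp lam * (\<Sum>j = 1..v p. h (p ^ j) / real p ^ j))"
proof -
  let ?F = "\<lambda>n. h n * exp (lam * real (omega n)) / real n"
  have "(\<Sum>n | n dvd (\<Prod>p\<in>G. p ^ v p). ?F n) = (\<Prod>p\<in>G. \<Sum>j\<le>v p. ?F (p ^ j))"
    using assms by (intro sum_divisors_prod_prime_powers)
      (auto simp: omega_1[unfolded One_nat_def] omega_mult exp_add algebra_simps)
  also have "\<dots> = (\<Prod>p\<in>G. 1 + exp lam * (\<Sum>j = 1..v p. h (p ^ j) / real p ^ j))"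
  proof (rule prod.cong[OF refl])
    fix p assume "p \<in> G"
    then have "(\<Sum>j = 1..v p. ?F (p ^ j)) = exp lam * (\<Sum>j = 1..v p. h (p ^ j) / real p ^ j)"
      unfolding sum_distrib_left using assms by (intro sum.cong) (auto simp: omega_prime_power)
    then show "(\<Sum>j\<le>v p. ?F (p ^ j)) = 1 + exp lam * (\<Sum>j = 1..v p. h (p ^ j) / real p ^ j)"
      using assms(1) by (simp add: sum_atMost_split_0 omega_1[unfolded One_nat_def])
  qed
  finally show ?thesis .
qed

text \<open>Writing n = p^j y with j >= 1 and y free of \<open>p\<close>, the sum factors into a
  truncated geometric series at \<open>p\<close> and an Euler product over the other primes. The
  series gives the factor 1 / (p - 1) and the strict inequality.\<close>

lemma sum_divisors_exp_omega_less:
  fixes v :: "nat \<Rightarrow> nat"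
  assumes G: "finite G" "\<And>p. p \<in> G \<Longrightarrow> prime p" and p: "p \<in> G"
  shows "(\<Sum>n | n dvd (\<Prod>q\<in>G. q ^ v q) \<and> p dvd n. exp (lam * real (omega n)) / real n)
    < exp lam / (real p - 1) * (\<Prod>q\<in>G. 1 + exp lam / (real q - 1))"
proof -
  let ?F = "\<lambda>n. exp (lam * real (omega n)) / real n"
  let ?W = "\<Prod>q\<in>G - {p}. q ^ v q"
  have pp: "prime p" using p G by auto
  have gt1: "real q > 1" if "q \<in> G" for q using G(2)[OF that] prime_gt_1_nat by simp
  have W: "(\<Prod>q\<in>G. q ^ v q) = p ^ v p * ?W" using G p by (simp add: prod.remove)
  have pos: "p ^ v p > 0" "?W > 0" using G pp by (auto intro!: prod_pos simp: prime_gt_0_nat)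
  have pW: "coprime p ?W"
    using G p by (intro prod_coprime_right) (auto intro!: primes_coprime simp: coprime_power_right_iff)
  have cop: "coprime (p ^ v p) ?W" using pW by simp
  have fin: "finite {n. n dvd (\<Prod>q\<in>G. q ^ v q)}"
    using pos W by (simp add: finite_divisors_nat)
  have "(\<Sum>n | n dvd (\<Prod>q\<in>G. q ^ v q) \<and> p dvd n. ?F n)
      = (\<Sum>n | n dvd (\<Prod>q\<in>G. q ^ v q). if p dvd n then ?F n else 0)"
    using sum.inter_filter[OF fin, of ?F "\<lambda>n. p dvd n"] by simp
  also have "\<dots> = (\<Sum>x | x dvd p ^ v p. \<Sum>y | y dvd ?W. if p dvd x * y then ?F (x * y) else 0)"
    unfolding W by (rule sum_divisors_coprime[OF cop pos])
  also have "\<dots> = (\<Sum>x | x dvd p ^ v p. \<Sum>y | y dvd ?W. (if p dvd x then ?F x else 0) * ?F y)"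
  proof (intro sum.cong refl)
    fix x y assume "x \<in> {x. x dvd p ^ v p}" "y \<in> {y. y dvd ?W}"
    then have xy: "x dvd p ^ v p" "y dvd ?W" by auto
    have "coprime p y" using coprime_divisors[OF dvd_refl xy(2) pW] .
    then have "p dvd x * y \<longleftrightarrow> p dvd x" by (simp add: coprime_dvd_mult_left_iff)
    moreover have "x > 0" "y > 0" using xy pos by (auto intro!: Nat.gr0I)
    moreover have "coprime x y" using coprime_divisors[OF xy cop] .
    ultimately show "(if p dvd x * y then ?F (x * y) else 0) = (if p dvd x then ?F x else 0) * ?F y"
      by (simp add: omega_mult exp_add distrib_left)
  qed
  also have "\<dots> = (\<Sum>x | x dvd p ^ v p. if p dvd x then ?F x else 0) * (\<Sum>y | y dvd ?W. ?F y)"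
    by (rule sum_product[symmetric])
  also have "(\<Sum>x | x dvd p ^ v p. if p dvd x then ?F x else 0) = exp lam * (\<Sum>j = 1..v p. 1 / real p ^ j)"
  proof -
    \<comment> \<open>The term j = 0 is excluded by the condition that \<open>p\<close> divides
      \<open>n\<close>.\<close>
    have "\<not> p dvd 1" using pp not_prime_unit by blast
    then have "(\<Sum>x | x dvd p ^ v p. if p dvd x then ?F x else 0) = (\<Sum>j = 1..v p. if p dvd p ^ j then ?F (p ^ j) else 0)"
      using pp by (simp add: sum_divisors_prime_power sum_atMost_split_0)
    also have "\<dots> = exp lam * (\<Sum>j = 1..v p. 1 / real p ^ j)"
      unfolding sum_distrib_left using pp by (intro sum.cong) (auto simp: omega_prime_power)
    finally show ?thesis .
  qed
  also have "(\<Sum>y | y dvd ?W. ?F y) = (\<Prod>q\<in>G - {p}. 1 + exp lam * (\<Sum>j = 1..v q. 1 / real q ^ j))"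
    using sum_divisors_exp_omega[of "\<lambda>_. 1" "G - {p}" lam v] G by simp
  also have "exp lam * (\<Sum>j = 1..v p. 1 / real p ^ j) * (\<Prod>q\<in>G - {p}. 1 + exp lam * (\<Sum>j = 1..v q. 1 / real q ^ j))
      < exp lam / (real p - 1) * (\<Prod>q\<in>G. 1 + exp lam / (real q - 1))"
  proof (rule mult_less_le_imp_less)
    show "exp lam * (\<Sum>j = 1..v p. 1 / real p ^ j) < exp lam / (real p - 1)"
      using geometric_sum_less[OF gt1[OF p], of "v p"] mult_strict_left_mono[of _ _ "exp lam"] by fastforce
    have "(\<Prod>q\<in>G - {p}. 1 + exp lam * (\<Sum>j = 1..v q. 1 / real q ^ j))
        \<le> (\<Prod>q\<in>G - {p}. 1 + exp lam / (real q - 1))"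
    proof (rule prod_mono, intro conjI)
      fix q assume q: "q \<in> G - {p}"
      show "0 \<le> 1 + exp lam * (\<Sum>j = 1..v q. 1 / real q ^ j)"
        by (intro add_nonneg_nonneg mult_nonneg_nonneg sum_nonneg) auto
      have "(\<Sum>j = 1..v q. 1 / real q ^ j) \<le> 1 / (real q - 1)"
        using geometric_sum_less[OF gt1[of q], of "v q"] q by auto
      then have "exp lam * (\<Sum>j = 1..v q. 1 / real q ^ j) \<le> exp lam * (1 / (real q - 1))"
        by (rule mult_left_mono) simp
      then show "1 + exp lam * (\<Sum>j = 1..v q. 1 / real q ^ j) \<le> 1 + exp lam / (real q - 1)" by simp
    qed
    \<comment> \<open>The missing factor at \<open>p\<close> is at least 1; putting it back makes
      the product the same for all \<open>p\<close>.\<close>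
    also have "\<dots> \<le> (1 + exp lam / (real p - 1)) * (\<Prod>q\<in>G - {p}. 1 + exp lam / (real q - 1))"
    proof -
      have "1 \<le> 1 + exp lam / (real p - 1)" using gt1[OF p] by simp
      moreover have "0 \<le> (\<Prod>q\<in>G - {p}. 1 + exp lam / (real q - 1))"
        using gt1 by (intro prod_nonneg) (auto intro!: add_nonneg_nonneg divide_nonneg_nonneg simp: less_imp_le)
      ultimately show ?thesis
        using mult_right_mono[of 1 "1 + exp lam / (real p - 1)"] by (metis mult_1)
    qed
    also have "\<dots> = (\<Prod>q\<in>G. 1 + exp lam / (real q - 1))" using G p by (simp add: prod.remove)
    finally show "(\<Prod>q\<in>G - {p}. 1 + exp lam * (\<Sum>j = 1..v q. 1 / real q ^ j))
      \<le> (\<Prod>q\<in>G. 1 + exp lam / (real q - 1))" .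
    show "0 \<le> exp lam * (\<Sum>j = 1..v p. 1 / real p ^ j)"
      by (intro mult_nonneg_nonneg sum_nonneg) auto
    show "0 < (\<Prod>q\<in>G - {p}. 1 + exp lam * (\<Sum>j = 1..v q. 1 / real q ^ j))"
      by (intro prod_pos ballI add_pos_nonneg mult_nonneg_nonneg sum_nonneg) auto
  qed
  finally show ?thesis .
qed

section \<open>Moments of congruence counts\<close>

text \<open>The congruence modulo \<open>d\<close> records the factors already expanded, which lets the induction on \<open>k\<close>
  combine congruences one at a time.\<close>

lemma moment_bound_aux:
  fixes mu :: "int \<Rightarrow> real" and K :: "nat \<Rightarrow> real" and w :: "'n \<Rightarrow> real" and c :: "nat \<Rightarrow> 'n \<Rightarrow> int"
  assumes q: "q > 0" and C: "finite C" "\<And>r. r \<in> C \<Longrightarrow> 0 \<le> mu r"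
    and K: "\<And>m b. m dvd q \<Longrightarrow> (\<Sum>r | r \<in> C \<and> [r = b] (mod int m). mu r) \<le> K m"
    and N: "finite N" "\<And>n. n \<in> N \<Longrightarrow> 0 \<le> w n" "\<And>n. n \<in> N \<Longrightarrow> D n \<subseteq> {m. m dvd q}"
    and d: "d dvd q"
  shows "(\<Sum>r | r \<in> C \<and> [r = b] (mod int d).
      mu r * (\<Sum>n\<in>N. w n * real (card {m \<in> D n. [r = c m n] (mod int m)})) ^ k)
    \<le> sum w N ^ k * (\<Sum>xs | set xs \<subseteq> {m. m dvd q} \<and> length xs = k. K (lcm d (Lcm (set xs))))"
  using d
proof (induction k arbitrary: d b)
  case 0
  have "{xs :: nat list. set xs \<subseteq> {m. m dvd q} \<and> length xs = 0} = {[]}" by auto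
  then show ?case using K[OF 0] by simp
next
  case (Suc k)
  define g where "g r = (\<Sum>n\<in>N. w n * real (card {m \<in> D n. [r = c m n] (mod int m)}))" for r
  define X where "X k = {xs. set xs \<subseteq> {m. m dvd q} \<and> length xs = k}" for k :: nat
  define H where "H k d = (\<Sum>xs\<in>X k. K (lcm d (Lcm (set xs))))" for k d
  let ?C = "{r. r \<in> C \<and> [r = b] (mod int d)}"
  have findiv: "finite {m. m dvd q}" using q by (simp add: finite_divisors_nat)
  have finD: "finite (D n)" if "n \<in> N" for n using N(3)[OF that] findiv finite_subset by blast
  \<comment> \<open>\<open>K m\<close> majorises a sum of non-negative masses.\<close>
  have K0: "K m \<ge> 0" if "m dvd q" for m
    using order_trans[OF sum_nonneg K[OF that, of 0]] C(2) by blast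
  have H0: "H k d \<ge> 0" if "d dvd q" for d
    unfolding H_def X_def using that by (intro sum_nonneg K0) (auto intro!: Lcm_least)
  have inner: "(\<Sum>r | r \<in> ?C \<and> [r = c m n] (mod int m). mu r * g r ^ k) \<le> sum w N ^ k * H k (lcm d m)"
    if m: "m dvd q" for m n
  \<comment> \<open>Two compatible congruences are one congruence modulo lcm d m, to which the
    induction hypothesis applies; incompatible ones leave an empty sum.\<close>
  proof (cases "\<exists>s. [s = b] (mod int d) \<and> [s = c m n] (mod int m)")
    case True
    then obtain s where s: "[s = b] (mod int d)" "[s = c m n] (mod int m)" by blast
    have "[r = s] (mod int (lcm d m)) \<longleftrightarrow> [r = b] (mod int d) \<and> [r = c m n] (mod int m)" for r
    proof -
      have "[r = s] (mod int (lcm d m)) \<longleftrightarrow> [r = s] (mod int d) \<and> [r = s] (mod int m)"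
        by (simp add: cong_iff_dvd_diff flip: lcm_int_int_eq)
      also have "\<dots> \<longleftrightarrow> [r = b] (mod int d) \<and> [r = c m n] (mod int m)"
        using s by (meson cong_sym cong_trans)
      finally show ?thesis .
    qed
    then have "{r. r \<in> ?C \<and> [r = c m n] (mod int m)} = {r. r \<in> C \<and> [r = s] (mod int (lcm d m))}"
      by auto
    then show ?thesis
      using Suc.IH[of "lcm d m" s] Suc.prems m unfolding g_def H_def X_def by simp
  next
    case False
    then have "{r. r \<in> ?C \<and> [r = c m n] (mod int m)} = {}" by blast
    moreover have "0 \<le> sum w N ^ k * H k (lcm d m)"
      using H0[of "lcm d m"] Suc.prems m N(2) by (intro mult_nonneg_nonneg zero_le_power sum_nonneg) auto
    ultimately show ?thesis by (simp only: sum.empty)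
  qed
  \<comment> \<open>One of the \<open>Suc k\<close> factors \<open>g r\<close> is expanded into its
    individual congruences; the sum over \<open>r\<close> is then moved inside.\<close>
  have "(\<Sum>r\<in>?C. mu r * g r ^ Suc k)
      = (\<Sum>r\<in>?C. \<Sum>n\<in>N. \<Sum>m\<in>D n. if [r = c m n] (mod int m) then w n * (mu r * g r ^ k) else 0)"
  proof (rule sum.cong[OF refl])
    fix r
    have "(\<Sum>n\<in>N. \<Sum>m\<in>D n. if [r = c m n] (mod int m) then w n * (mu r * g r ^ k) else 0)
        = (\<Sum>n\<in>N. w n * real (card {m \<in> D n. [r = c m n] (mod int m)}) * (mu r * g r ^ k))"
      using finD by (intro sum.cong refl) (simp flip: sum.inter_filter)
    also have "\<dots> = g r * (mu r * g r ^ k)"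
      by (simp add: sum_distrib_right g_def)
    finally show "mu r * g r ^ Suc k
      = (\<Sum>n\<in>N. \<Sum>m\<in>D n. if [r = c m n] (mod int m) then w n * (mu r * g r ^ k) else 0)"
      by (simp add: algebra_simps)
  qed
  also have "\<dots> = (\<Sum>n\<in>N. \<Sum>m\<in>D n. \<Sum>r\<in>?C. if [r = c m n] (mod int m) then w n * (mu r * g r ^ k) else 0)"
    by (subst sum.swap, intro sum.cong refl, rule sum.swap)
  also have "\<dots> = (\<Sum>n\<in>N. w n * (\<Sum>m\<in>D n. \<Sum>r | r \<in> ?C \<and> [r = c m n] (mod int m). mu r * g r ^ k))"
    unfolding sum_distrib_left
    by (rule sum.cong[OF refl], rule sum.cong[OF refl], rule sum.inter_filter[symmetric])
      (simp add: C)
  also have "\<dots> \<le> (\<Sum>n\<in>N. w n * (sum w N ^ k * H (Suc k) d))"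
  proof (intro sum_mono mult_left_mono N(2))
    fix n assume n: "n \<in> N"
    have "(\<Sum>m\<in>D n. \<Sum>r | r \<in> ?C \<and> [r = c m n] (mod int m). mu r * g r ^ k)
        \<le> (\<Sum>m\<in>D n. sum w N ^ k * H k (lcm d m))"
      using N(3)[OF n] by (intro sum_mono inner) auto
    \<comment> \<open>Enlarging \<open>D n\<close> to all divisors of \<open>q\<close> makes the
      bound independent of \<open>n\<close>; the new divisor \<open>m\<close> then becomes the head
      of a list of length \<open>Suc k\<close>.\<close>
    also have "\<dots> \<le> (\<Sum>m | m dvd q. sum w N ^ k * H k (lcm d m))"
      using N(2) Suc.prems H0
      by (intro sum_mono2 findiv N(3)[OF n] mult_nonneg_nonneg zero_le_power sum_nonneg) auto
    also have "\<dots> = sum w N ^ k * (\<Sum>m | m dvd q. H k (lcm d m))"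
      by (simp add: sum_distrib_left)
    also have "(\<Sum>m | m dvd q. H k (lcm d m)) = H (Suc k) d"
    proof -
      have "H (Suc k) d = (\<Sum>(xs, m)\<in>X k \<times> {m. m dvd q}. K (lcm d (Lcm (set (m # xs)))))"
        unfolding H_def X_def lists_length_Suc_eq
        by (subst sum.reindex) (auto simp: inj_on_def o_def case_prod_unfold)
      also have "\<dots> = (\<Sum>xs\<in>X k. \<Sum>m | m dvd q. K (lcm (lcm d m) (Lcm (set xs))))"
        by (simp add: sum.cartesian_product lcm.assoc)
      also have "\<dots> = (\<Sum>m | m dvd q. H k (lcm d m))"
        unfolding H_def by (rule sum.swap)
      finally show ?thesis by simp
    qed
    finally show "(\<Sum>m\<in>D n. \<Sum>r | r \<in> ?C \<and> [r = c m n] (mod int m). mu r * g r ^ k)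
        \<le> sum w N ^ k * H (Suc k) d" .
  qed
  also have "\<dots> = sum w N ^ Suc k * H (Suc k) d"
    by (simp add: sum_distrib_right mult.assoc)
  finally show ?case unfolding g_def H_def X_def .
qed

text \<open>The case d = 1, with the lists grouped by their lcm.\<close>

lemma moment_bound:
  fixes mu :: "int \<Rightarrow> real" and K :: "nat \<Rightarrow> real" and w :: "'n \<Rightarrow> real" and c :: "nat \<Rightarrow> 'n \<Rightarrow> int"
  assumes "q > 0" "finite C" "\<And>r. r \<in> C \<Longrightarrow> 0 \<le> mu r"
    and "\<And>m b. m dvd q \<Longrightarrow> (\<Sum>r | r \<in> C \<and> [r = b] (mod int m). mu r) \<le> K m"
    and "finite N" "\<And>n. n \<in> N \<Longrightarrow> 0 \<le> w n" "\<And>n. n \<in> N \<Longrightarrow> D n \<subseteq> {m. m dvd q}"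
  shows "(\<Sum>r\<in>C. mu r * (\<Sum>n\<in>N. w n * real (card {m \<in> D n. [r = c m n] (mod int m)})) ^ k)
    \<le> sum w N ^ k * (\<Sum>m | m dvd q. real (ell k m) * K m)"
  using moment_bound_aux[OF assms one_dvd, where b = 0 and k = k and c = c]
    sum_lists_Lcm[OF assms(1), of K k] by simp

section \<open>One step of the sieve\<close>

locale sieve =
  fixes Ms :: "nat set" and a :: "nat \<Rightarrow> int" and P :: "nat \<Rightarrow> real" and lam :: real
  assumes P_mono: "strict_mono P" and lam_pos: "lam > 0"
begin

abbreviation "q \<equiv> Q Ms P"
abbreviation "G \<equiv> new_primes P"
abbreviation "N \<equiv> new_moduli Ms P"
abbreviation "A \<equiv> new_set Ms a P"
abbreviation "S \<equiv> R Ms a P"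
abbreviation "is_good \<equiv> good Ms a P lam"
abbreviation "mass \<equiv> mu Ms a P lam"
abbreviation "\<mu> \<equiv> mu_set Ms a P lam"

definition W :: "nat \<Rightarrow> nat" where
  "W i = (\<Prod>p\<in>G i. p ^ v Ms p)"

definition T :: "nat \<Rightarrow> int set" where
  "T i = Rstar_pred Ms a P lam i \<inter> S i"

definition good_set :: "nat \<Rightarrow> int set" where
  "good_set i = Rstar Ms a P lam i"

section \<open>Old primes, new primes, and the sets of one stage\<close>

lemma finite_primes_le: "finite {p :: nat. prime p \<and> real p \<le> x}"
proof (rule finite_subset)
  show "{p :: nat. prime p \<and> real p \<le> x} \<subseteq> {..nat \<lfloor>x\<rfloor>}" by (auto simp: le_nat_floor)
qed simp

lemma finite_G: "finite (G i)"
  unfolding new_primes_def by (rule finite_subset[OF _ finite_primes_le[of "P (Suc i)"]]) auto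

lemma prime_G: "p \<in> G i \<Longrightarrow> prime p"
  by (simp add: new_primes_def)

lemma q_pos: "q i > 0"
  unfolding Q_def by (auto intro!: prod_pos simp: prime_gt_0_nat)

lemma W_pos: "W i > 0"
  unfolding W_def by (auto intro!: prod_pos simp: prime_gt_0_nat prime_G)

lemma q_Suc: "q (Suc i) = W i * q i"
proof -
  have "P i < P (Suc i)" using P_mono by (simp add: strict_monoD)
  then have "{p. prime p \<and> real p \<le> P (Suc i)} = G i \<union> {p. prime p \<and> real p \<le> P i}"
    by (auto simp: new_primes_def)
  moreover have "G i \<inter> {p. prime p \<and> real p \<le> P i} = {}" by (auto simp: new_primes_def)
  ultimately show ?thesis
    unfolding Q_def W_def by (simp add: prod.union_disjoint finite_G finite_primes_le)
qed

lemma coprime_q_new: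
  assumes "n > 0" "\<And>p. prime p \<Longrightarrow> p dvd n \<Longrightarrow> P i < real p"
  shows "coprime n (q i)"
  unfolding Q_def using assms
  by (intro coprime_prod_prime_powers finite_primes_le) (auto simp: prime_factors_dvd not_less[symmetric])

lemma prime_dvd_W: "prime p \<Longrightarrow> p dvd W i \<Longrightarrow> p \<in> G i"
  using prime_factors_dvd_prod_prime_powers[OF finite_G[of i] prime_G[of _ i], of "W i" "v Ms"] W_pos[of i]
  by (auto simp: W_def prime_factors_dvd)

lemma coprime_W_q: "coprime (W i) (q i)"
  by (rule coprime_q_new[OF W_pos]) (auto dest: prime_dvd_W simp: new_primes_def)

text \<open>This is the shape in which the local lemma indexes its events. All primes of n exceed
  P_i, so n is coprime to \<open>q i\<close> and divides the factor \<open>W i\<close>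
  alone.\<close>

lemma N_eq: "N i = {n. n dvd W i \<and> n > 1}"
proof (intro Set.equalityI subsetI)
  fix n assume "n \<in> N i"
  then have n: "n dvd W i * q i" "n > 1" "\<And>p. prime p \<Longrightarrow> p dvd n \<Longrightarrow> P i < real p"
    by (auto simp: new_moduli_def q_Suc)
  then have "coprime n (q i)" by (intro coprime_q_new) auto
  then show "n \<in> {n. n dvd W i \<and> n > 1}" using n by (simp add: coprime_dvd_mult_left_iff)
next
  fix n assume "n \<in> {n. n dvd W i \<and> n > 1}"
  then show "n \<in> N i"
    using prime_dvd_W[of _ i] by (auto simp: new_moduli_def q_Suc new_primes_def intro: dvd_trans)
qed

lemma periodic_S: "periodic (q i) (S i)"
  unfolding R_def moduli_def
  by (intro periodic_INT periodic_Compl) (auto intro: periodic_dvd[OF periodic_res_class])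

lemma is_good_cong:
  assumes "[x = y] (mod int (q i))"
  shows "is_good i x \<longleftrightarrow> is_good i y"
  using res_class_cong[OF assms] by (simp add: good_def new_set_def)

lemma periodic_good_set: "periodic (q i) (good_set i)"
  unfolding good_set_def Rstar_def Rstar_pred.simps
  by (intro periodic_UN periodic_res_class)

lemma periodic_T: "periodic (q i) (T i)"
proof (cases i)
  case 0
  then show ?thesis using periodic_S[of i] by (simp add: T_def)
next
  case (Suc j)
  have "periodic (q i) (good_set j)"
    using periodic_good_set by (rule periodic_dvd) (simp add: Suc q_Suc)
  then show ?thesis
    using periodic_Int[OF _ periodic_S[of i]] by (simp add: T_def Suc good_set_def Rstar_def)
qed

text \<open>Goodness of \<open>r\<close> depends only on its class modulo \<open>q i\<close>, so the
  union of good classes is just a filter on \<open>T i\<close>.\<close>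

lemma mem_good_set_iff: "x \<in> good_set i \<longleftrightarrow> x \<in> T i \<and> is_good i x"
proof
  assume "x \<in> good_set i"
  then obtain r where r: "r \<in> T i" "is_good i r" "[x = r] (mod int (q i))"
    by (auto simp: good_set_def Rstar_def T_def res_class_def)
  then show "x \<in> T i \<and> is_good i x"
    using periodicD[OF periodic_T r(3)] is_good_cong[OF r(3)] by simp
next
  assume "x \<in> T i \<and> is_good i x"
  then show "x \<in> good_set i"
    using mem_res_class_self[of x "q i"] by (auto simp: good_set_def Rstar_def T_def)
qed

lemma good_set_subset: "good_set i \<subseteq> T i"
  using mem_good_set_iff by blast

lemma T_Suc: "T (Suc i) = good_set i \<inter> S (Suc i)"
  by (simp add: T_def good_set_def Rstar_def)

text \<open>Each modulus at stage i + 1 splits as n m0 with n dividing \<open>W i\<close> and m0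
  dividing \<open>q i\<close>. For n = 1 it is an old modulus, already avoided on the fibre; for n >
  1 its class meets the fibre inside \<open>A i n r\<close>.\<close>

lemma mem_S_Suc_iff:
  assumes "r \<in> S i" "x \<in> res_class r (q i)"
  shows "x \<in> S (Suc i) \<longleftrightarrow> (\<forall>n\<in>N i. x \<notin> A i n r)"
proof
  assume x: "x \<in> S (Suc i)"
  show "\<forall>n\<in>N i. x \<notin> A i n r" using x by (auto simp: new_set_def R_def)
next
  assume x: "\<forall>n\<in>N i. x \<notin> A i n r"
  have xS: "x \<in> S i"
    using assms periodicD[OF periodic_S, of x r i] by (simp add: res_class_def)
  show "x \<in> S (Suc i)"
    unfolding R_def
  proof (rule INT_I, rule ComplI)
    fix m assume m: "m \<in> moduli Ms P (Suc i)" and xm: "x \<in> res_class (a m) m"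
    then have "m dvd W i * q i" "m \<in> Ms" by (auto simp: moduli_def q_Suc)
    then obtain n m0 where nm: "m = n * m0" "n dvd W i" "m0 dvd q i" using division_decomp by blast
    have n0: "n > 0" using nm W_pos[of i] by (auto intro!: Nat.gr0I)
    show False
    proof (cases "n = 1")
      case True
      then have "m \<in> moduli Ms P i" using nm \<open>m \<in> Ms\<close> by (simp add: moduli_def)
      then show False using xS xm by (auto simp: R_def)
    next
      case False
      then have "n \<in> N i" using nm n0 by (simp add: N_eq)
      moreover have "x \<in> A i n r"
        using assms(2) nm m xm by (auto simp: new_set_def mult.commute)
      ultimately show False using x by blast
    qed
  qed
qed

lemma periodic_A: "periodic (n * q i) (A i n r)"
  unfolding new_set_def
proof (intro periodic_Int periodic_UN)
  show "periodic (n * q i) (res_class r (q i))"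
    by (rule periodic_dvd[OF periodic_res_class]) simp
  fix m0 assume "m0 \<in> {m0. m0 dvd q i \<and> m0 * n \<in> moduli Ms P (Suc i)}"
  then show "periodic (n * q i) (res_class (a (m0 * n)) (m0 * n))"
    by (intro periodic_dvd[OF periodic_res_class]) (auto simp: mult.commute intro: mult_dvd_mono)
qed

text \<open>In the fibre coordinate t, with x = r + q t, the sets \<open>A i n r\<close> become
  events \<open>E n\<close> of period \<open>n\<close>, and goodness of \<open>r\<close> becomes the
  condition of the local lemma on Z/W.\<close>

lemma fibre_local_lemma:
  assumes "r \<in> S i" "is_good i r"
  shows "num_classes (q (Suc i)) (S (Suc i) \<inter> res_class r (q i)) > 0"
    and "d dvd W i \<Longrightarrow> real (num_classes (q (Suc i)) (S (Suc i) \<inter> res_class r (q i) \<inter> res_class b d))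
      \<le> exp (lam * real (omega d)) / real d *
        real (num_classes (q (Suc i)) (S (Suc i) \<inter> res_class r (q i)))"
proof -
  define E where "E n = {t. r + int (q i) * t \<in> A i n r}" for n
  define U where "U = {t. \<forall>n\<in>N i. t \<notin> E n}"
  let ?X = "S (Suc i) \<inter> res_class r (q i)"
  have perX: "periodic (W i * q i) ?X"
    using periodic_Int[OF periodic_S[of "Suc i"]
        periodic_dvd[OF periodic_res_class, of "q i" "q (Suc i)" r]] by (simp add: q_Suc)
  have E: "num_classes (n * q i) (A i n r) = num_classes n (E n)" "periodic n (E n)" if "n \<in> N i" for n
    using num_classes_fibre[OF q_pos _ periodic_A, of n i r r] that
    by (auto simp: E_def N_eq new_set_def)
  have U: "{t. r + int (q i) * t \<in> ?X} = U"
  proof -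
    have "r + int (q i) * t \<in> res_class r (q i)" for t by (simp add: res_class_def cong_def)
    then show ?thesis using mem_S_Suc_iff[OF assms(1)] by (auto simp: U_def E_def)
  qed
  have X: "real (num_classes (q (Suc i)) ?X) = real (W i) * density (W i) U"
    using num_classes_fibre(1)[OF q_pos W_pos perX Int_lower2, unfolded U] W_pos[of i]
    by (simp add: q_Suc density_def)
  have LL: "density (W i) U > 0"
    "\<And>d c. d dvd W i \<Longrightarrow> density (W i) (U \<inter> res_class c d)
       \<le> exp (lam * real (omega d)) / real d * density (W i) U"
  proof -
    have gd: "(\<Sum>n | n \<in> N i \<and> p dvd n. real (num_classes n (E n)) * exp (lam * real (omega n)) / real n)
        \<le> 1 - exp (- lam)" if "p \<in> G i" for p
    proof -
      have "(\<Sum>n | n \<in> N i \<and> p dvd n. real (num_classes n (E n)) * exp (lam * real (omega n)) / real n)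
        = (\<Sum>n | n \<in> N i \<and> p dvd n.
            real (num_classes (n * q i) (A i n r)) * exp (lam * real (omega n)) / real n)"
        by (intro sum.cong refl) (simp add: E)
      then show ?thesis using assms(2) that by (simp add: good_def)
    qed
    note ll = local_lemma_prime_powers[OF W_def N_eq U_def finite_G prime_G less_imp_le[OF lam_pos] E(2) gd]
    show "density (W i) U > 0"
      by (rule ll(1))
    show "density (W i) (U \<inter> res_class c d) \<le> exp (lam * real (omega d)) / real d * density (W i) U"
      if "d dvd W i" for c d
      by (rule ll(2)[OF _ _ _ that])
  qed
  show "num_classes (q (Suc i)) ?X > 0"
    using X LL(1) W_pos[of i] by (metis mult_pos_pos of_nat_0_less_iff)
  assume d: "d dvd W i"
  have "coprime (q i) d" using coprime_divisors[OF d dvd_refl coprime_W_q] by (simp add: coprime_commute)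
  then obtain u where u: "[int (q i) * u = 1] (mod int d)"
    using cong_solve_coprime_int[of "int (q i)" "int d"] by auto
  \<comment> \<open>As \<open>q i\<close> is invertible modulo \<open>d\<close> with inverse
    \<open>u\<close>, the condition r + q t = b modulo \<open>d\<close> is a single class for
    t.\<close>
  define c where "c = u * (b - r)"
  have cong: "[r + int (q i) * t = b] (mod int d) \<longleftrightarrow> [t = c] (mod int d)" for t
  proof -
    have "[int (q i) * c = b - r] (mod int d)"
      using cong_scalar_right[OF u, of "b - r"] by (simp add: c_def mult.assoc)
    then have "[r + int (q i) * c = b] (mod int d)"
      using cong_add[OF cong_refl[of r]] by fastforce
    then have "[r + int (q i) * t = b] (mod int d) \<longleftrightarrow> [r + int (q i) * t = r + int (q i) * c] (mod int d)"
      by (meson cong_sym cong_trans)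
    also have "\<dots> \<longleftrightarrow> [t = c] (mod int d)"
      using \<open>coprime (q i) d\<close> by (simp add: cong_add_lcancel cong_mult_lcancel)
    finally show ?thesis .
  qed
  have perY: "periodic (W i * q i) (?X \<inter> res_class b d)"
    by (intro periodic_Int[OF perX] periodic_dvd[OF periodic_res_class]) (use d in simp)
  have "{t. r + int (q i) * t \<in> ?X \<inter> res_class b d} = U \<inter> res_class c d"
    using U cong by (auto simp: res_class_def)
  then have "real (num_classes (q (Suc i)) (?X \<inter> res_class b d)) = real (W i) * density (W i) (U \<inter> res_class c d)"
    using num_classes_fibre(1)[OF q_pos W_pos perY, of r] W_pos[of i] by (auto simp: q_Suc density_def)
  also have "\<dots> \<le> real (W i) * (exp (lam * real (omega d)) / real d * density (W i) U)"
    by (intro mult_left_mono LL(2) d) simp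
  finally show "real (num_classes (q (Suc i)) (?X \<inter> res_class b d))
      \<le> exp (lam * real (omega d)) / real d * real (num_classes (q (Suc i)) ?X)"
    by (simp add: X mult.left_commute)
qed


section \<open>Passing from one measure to the next\<close>

lemma mass_nonneg: "mass i r \<ge> 0"
  by (induction i arbitrary: r) auto

lemma \<mu>_periodic: "periodic (q i) X \<Longrightarrow> \<mu> i X = (\<Sum>r\<in>X \<inter> {0..<int (q i)}. mass i r)"
  by (simp add: mu_set_def classes_mod_periodic q_pos)

lemma \<mu>_nonneg: "\<mu> i X \<ge> 0"
  unfolding mu_set_def by (intro sum_nonneg mass_nonneg)

lemma periodic_T_class: "m dvd q i \<Longrightarrow> periodic (q i) (T i \<inter> res_class b m)"
  by (intro periodic_Int periodic_T periodic_dvd[OF periodic_res_class])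

lemma \<mu>_T_class:
  assumes "m dvd q i"
  shows "\<mu> i (T i \<inter> res_class b m) = (\<Sum>r | r \<in> T i \<inter> {0..<int (q i)} \<and> [r = b] (mod int m). mass i r)"
  unfolding \<mu>_periodic[OF periodic_T_class[OF assms]]
  by (rule sum.cong) (auto simp: res_class_def)

text \<open>The mass of each good class is spread evenly over the surviving part of its fibre, so
  \<open>X\<close> receives the proportion of that part which it occupies.\<close>

lemma \<mu>_Suc:
  assumes per: "periodic (q (Suc i)) X" and sub: "X \<subseteq> T (Suc i)"
  shows "\<mu> (Suc i) X = (\<Sum>r\<in>good_set i \<inter> {0..<int (q i)}.
    mass i r * (real (num_classes (q (Suc i)) (X \<inter> res_class r (q i))) /
      real (num_classes (q (Suc i)) (S (Suc i) \<inter> res_class r (q i)))))"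
proof -
  let ?X = "X \<inter> {0..<int (q (Suc i))}" and ?B = "good_set i \<inter> {0..<int (q i)}"
  have "\<mu> (Suc i) X = (\<Sum>x\<in>?X. mass (Suc i) x)" by (rule \<mu>_periodic[OF per])
  also have "\<dots> = (\<Sum>r\<in>?B. \<Sum>x | x \<in> ?X \<and> x mod int (q i) = r. mass (Suc i) x)"
  proof (rule sum.group[symmetric])
    show "(\<lambda>x. x mod int (q i)) ` ?X \<subseteq> ?B"
    proof clarify
      fix x assume "x \<in> X"
      then have "x \<in> good_set i" using sub by (auto simp: T_Suc)
      then show "x mod int (q i) \<in> good_set i \<inter> {0..<int (q i)}"
        using periodicD[OF periodic_good_set, of "x mod int (q i)" x i] q_pos[of i] by (simp add: cong_def)
    qed
  qed auto
  also have "\<dots> = (\<Sum>r\<in>?B. mass i r * (real (num_classes (q (Suc i)) (X \<inter> res_class r (q i))) /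
      real (num_classes (q (Suc i)) (S (Suc i) \<inter> res_class r (q i)))))"
  proof (rule sum.cong[OF refl])
    fix r assume r: "r \<in> ?B"
    let ?n = "real (num_classes (q (Suc i)) (S (Suc i) \<inter> res_class r (q i)))"
    have set_eq: "{x. x \<in> ?X \<and> x mod int (q i) = r} = classes_mod (q (Suc i)) (X \<inter> res_class r (q i))"
    proof -
      have "periodic (q (Suc i)) (X \<inter> res_class r (q i))"
        by (intro periodic_Int[OF per] periodic_dvd[OF periodic_res_class]) (simp add: q_Suc)
      then show ?thesis using r q_pos by (auto simp: classes_mod_periodic res_class_def cong_def)
    qed
    have "(\<Sum>x | x \<in> ?X \<and> x mod int (q i) = r. mass (Suc i) x) = (\<Sum>x | x \<in> ?X \<and> x mod int (q i) = r. mass i r / ?n)"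
    proof (rule sum.cong[OF refl])
      fix x assume x: "x \<in> {x. x \<in> ?X \<and> x mod int (q i) = r}"
      then have "x \<in> good_set i \<inter> S (Suc i)" using sub T_Suc by auto
      moreover have "res_class x (q i) = res_class r (q i)" using x res_class_mod[of x "q i"] by simp
      ultimately show "mass (Suc i) x = mass i r / ?n" using x by (simp add: good_set_def)
    qed
    also have "\<dots> = mass i r * (real (num_classes (q (Suc i)) (X \<inter> res_class r (q i))) / ?n)"
      unfolding set_eq num_classes_def by simp
    finally show "(\<Sum>x | x \<in> ?X \<and> x mod int (q i) = r. mass (Suc i) x)
      = mass i r * (real (num_classes (q (Suc i)) (X \<inter> res_class r (q i))) / ?n)" .
  qed
  finally show ?thesis .
qed

lemma fibre_in_good_set:
  assumes "r \<in> good_set i"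
  shows "res_class r (q i) \<subseteq> good_set i"
  using periodicD[OF periodic_good_set] assms by (auto simp: res_class_def)

lemma good_set_local:
  assumes "r \<in> good_set i"
  shows "r \<in> S i" "is_good i r"
  using assms mem_good_set_iff by (auto simp: T_def)

text \<open>Surviving fibres over good classes are non-empty, so no mass is lost to a division by
  zero.\<close>

lemma \<mu>_Suc_T: "\<mu> (Suc i) (T (Suc i)) = \<mu> i (good_set i)"
proof -
  have "mass i r * (real (num_classes (q (Suc i)) (T (Suc i) \<inter> res_class r (q i))) /
      real (num_classes (q (Suc i)) (S (Suc i) \<inter> res_class r (q i)))) = mass i r"
    if "r \<in> good_set i" for r
  proof -
    have "T (Suc i) \<inter> res_class r (q i) = S (Suc i) \<inter> res_class r (q i)"
      using fibre_in_good_set[OF that] by (auto simp: T_Suc)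
    then show ?thesis using fibre_local_lemma(1)[OF good_set_local[OF that]] by simp
  qed
  then show ?thesis
    unfolding \<mu>_Suc[OF periodic_T subset_refl] \<mu>_periodic[OF periodic_good_set]
    by (intro sum.cong) auto
qed

text \<open>The condition modulo \<open>m\<close> concerns only the base class \<open>r\<close>,
  since \<open>m\<close> divides \<open>q i\<close>. The condition modulo \<open>n\<close> lives in
  the fibre, where the local lemma bounds its share.\<close>

lemma \<mu>_Suc_T_class:
  assumes "m dvd q i" "n dvd W i"
  shows "\<mu> (Suc i) (T (Suc i) \<inter> res_class b (m * n))
    \<le> exp (lam * real (omega n)) / real n * \<mu> i (T i \<inter> res_class b m)"
proof -
  have dvd: "m * n dvd q (Suc i)" 
    using mult_dvd_mono[OF assms] by (simp add: q_Suc mult.commute)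
  let ?c = "exp (lam * real (omega n)) / real n"
  let ?Y = "good_set i \<inter> {0..<int (q i)}"
  have "\<mu> (Suc i) (T (Suc i) \<inter> res_class b (m * n))
      = (\<Sum>r\<in>?Y. mass i r * (real (num_classes (q (Suc i)) (T (Suc i) \<inter> res_class b (m * n) \<inter> res_class r (q i))) /
      real (num_classes (q (Suc i)) (S (Suc i) \<inter> res_class r (q i)))))"
    by (rule \<mu>_Suc[OF periodic_T_class[OF dvd]]) auto
  also have "\<dots> \<le> (\<Sum>r\<in>?Y. if [r = b] (mod int m) then ?c * mass i r else 0)"
  proof (rule sum_mono)
    fix r assume r: "r \<in> ?Y"
    let ?n = "real (num_classes (q (Suc i)) (S (Suc i) \<inter> res_class r (q i)))"
    let ?X = "T (Suc i) \<inter> res_class b (m * n) \<inter> res_class r (q i)"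
    have loc: "r \<in> S i" "is_good i r" using good_set_local r by auto
    show "mass i r * (real (num_classes (q (Suc i)) ?X) / ?n) \<le> (if [r = b] (mod int m) then ?c * mass i r else 0)"
    proof (cases "[r = b] (mod int m)")
      case True
      have "?X \<subseteq> S (Suc i) \<inter> res_class r (q i) \<inter> res_class b n"
        by (auto simp: T_Suc res_class_def intro: cong_dvd_modulus)
      then have "real (num_classes (q (Suc i)) ?X)
          \<le> real (num_classes (q (Suc i)) (S (Suc i) \<inter> res_class r (q i) \<inter> res_class b n))"
        unfolding num_classes_def using finite_classes_mod[OF q_pos]
        by (intro of_nat_mono card_mono) (auto simp: classes_mod_def)
      also have "\<dots> \<le> ?c * ?n" by (rule fibre_local_lemma(2)[OF loc assms(2)])
      finally have "real (num_classes (q (Suc i)) ?X) / ?n \<le> ?c"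
        using fibre_local_lemma(1)[OF loc] by (simp add: divide_le_eq)
      then have "mass i r * (real (num_classes (q (Suc i)) ?X) / ?n) \<le> mass i r * ?c"
        by (rule mult_left_mono[OF _ mass_nonneg])
      then show ?thesis using True by (simp add: mult.commute)
    next
      case False
      have "?X = {}"
      proof (rule equals0I)
        fix x assume "x \<in> ?X"
        then have "[x = b] (mod int (m * n))" "[x = r] (mod int (q i))" by (auto simp: res_class_def)
        then have "[x = b] (mod int m)" "[x = r] (mod int m)"
          using assms(1) by (auto intro: cong_dvd_modulus)
        then show False using False by (meson cong_sym cong_trans)
      qed
      then show ?thesis using False by (simp add: num_classes_def classes_mod_def)
    qed
  qed
  \<comment> \<open>Classes that are not good are added back; their terms are non-negative.\<close>
  also have "\<dots> \<le> (\<Sum>r\<in>T i \<inter> {0..<int (q i)}. if [r = b] (mod int m) then ?c * mass i r else 0)"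
    using good_set_subset mass_nonneg by (intro sum_mono2) auto
  also have "\<dots> = ?c * \<mu> i (T i \<inter> res_class b m)"
    unfolding \<mu>_T_class[OF assms(1)] sum_distrib_left by (rule sum.inter_filter[symmetric]) simp
  finally show ?thesis .
qed

section \<open>The bias statistics and their growth\<close>

definition bias_max :: "nat \<Rightarrow> nat \<Rightarrow> real" where
  "bias_max i m = (MAX b \<in> {0..<int m}. \<mu> i (T i \<inter> res_class b m) / \<mu> i (T i))"

lemma bias_max_ge:
  assumes "m > 0"
  shows "\<mu> i (T i \<inter> res_class b m) / \<mu> i (T i) \<le> bias_max i m"
proof -
  have "\<mu> i (T i \<inter> res_class (b mod int m) m) / \<mu> i (T i) \<le> bias_max i m"
    unfolding bias_max_def using assms by (intro Max_ge) auto
  then show ?thesis by (simp add: res_class_mod)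
qed

lemma bias_max_le:
  assumes "m > 0" "\<And>b. \<mu> i (T i \<inter> res_class b m) / \<mu> i (T i) \<le> c"
  shows "bias_max i m \<le> c"
  unfolding bias_max_def using assms by (subst Max_le_iff) auto

lemma bias_max_nonneg: "m > 0 \<Longrightarrow> bias_max i m \<ge> 0"
  using order_trans[OF divide_nonneg_nonneg[OF \<mu>_nonneg \<mu>_nonneg] bias_max_ge] by blast

lemma bias_power:
  assumes "k \<ge> 1"
  shows "bias Ms a P lam k i ^ k = (\<Sum>m | m dvd q i. real (ell k m) * bias_max i m)"
proof -
  have "bias Ms a P lam k i = root k (\<Sum>m | m dvd q i. real (ell k m) * bias_max i m)"
    by (simp add: bias_def bias_max_def T_def)
  moreover have "0 \<le> (\<Sum>m | m dvd q i. real (ell k m) * bias_max i m)"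
    using q_pos[of i] by (intro sum_nonneg mult_nonneg_nonneg bias_max_nonneg) (auto intro!: Nat.gr0I)
  ultimately show ?thesis using assms by simp
qed

text \<open>The modulus 1 alone contributes at least 1. Positivity is needed because the hypothesis
  of the theorem divides by the bias.\<close>

lemma bias_pos:
  assumes "k \<ge> 1" "\<mu> i (T i) > 0"
  shows "bias Ms a P lam k i > 0"
proof -
  have "res_class 0 1 = UNIV" by (simp add: res_class_def)
  then have 1: "1 \<le> bias_max i 1" using bias_max_ge[of 1 i 0] assms(2) by simp
  have "real (ell k 1) * bias_max i 1 \<le> (\<Sum>m | m dvd q i. real (ell k m) * bias_max i m)"
    using q_pos[of i] by (intro member_le_sum mult_nonneg_nonneg bias_max_nonneg)
      (auto intro!: Nat.gr0I simp: finite_divisors_nat)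
  then have pos: "bias Ms a P lam k i ^ k > 0" using 1 assms(1) by (simp add: bias_power ell_1[unfolded One_nat_def])
  have "bias Ms a P lam k i \<ge> 0"
    unfolding bias_def using q_pos[of i] assms(1)
    by (auto intro!: real_root_ge_zero sum_nonneg mult_nonneg_nonneg Nat.gr0I
        bias_max_nonneg[unfolded bias_max_def T_def])
  then show ?thesis using pos assms(1) by (metis less_eq_real_def not_less_zero power_0_left less_le not_one_le_zero)
qed

text \<open>Divisors of \<open>q (Suc i)\<close> split as m n with m old and n new, and the bound
  for each splits accordingly: the sum over m is the old statistic, the sum over n an Euler
  product.\<close>

lemma bias_Suc_le:
  assumes "k \<ge> 1" "c > 0" "\<mu> i (T i) > 0" "\<mu> i (good_set i) \<ge> c * \<mu> i (T i)"
  shows "bias Ms a P lam k (Suc i) ^ k \<le> bias Ms a P lam k i ^ k / c *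
    (\<Prod>p\<in>G i. 1 + exp lam * (\<Sum>j = 1..v Ms p. (real (j + 1) ^ k - real j ^ k) / real p ^ j))"
proof -
  let ?e = "\<lambda>n. exp (lam * real (omega n)) / real n"
  have max_le: "bias_max (Suc i) (m * n) \<le> ?e n * bias_max i m / c" if mn: "m dvd q i" "n dvd W i" for m n
  proof (rule bias_max_le)
    have pos: "m > 0" "n > 0" using mn q_pos[of i] W_pos[of i] by (auto intro!: Nat.gr0I)
    then show "m * n > 0" by simp
    fix b
    \<comment> \<open>The new total mass is that of \<open>good_set i\<close>, at least
      \<open>c\<close> times the old one; this is the only source of the factor 1 / c.\<close>
    have "\<mu> (Suc i) (T (Suc i) \<inter> res_class b (m * n)) / \<mu> (Suc i) (T (Suc i))
        \<le> (?e n * \<mu> i (T i \<inter> res_class b m)) / (c * \<mu> i (T i))"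
      unfolding \<mu>_Suc_T using assms \<mu>_Suc_T_class[OF mn] \<mu>_nonneg
      by (intro frac_le) auto
    also have "\<dots> = ?e n * (\<mu> i (T i \<inter> res_class b m) / \<mu> i (T i)) / c" by simp
    also have "\<dots> \<le> ?e n * bias_max i m / c"
      using assms(2) by (intro divide_right_mono mult_left_mono bias_max_ge pos) auto
    finally show "\<mu> (Suc i) (T (Suc i) \<inter> res_class b (m * n)) / \<mu> (Suc i) (T (Suc i))
      \<le> ?e n * bias_max i m / c" .
  qed
  have "bias Ms a P lam k (Suc i) ^ k = (\<Sum>m | m dvd q i * W i. real (ell k m) * bias_max (Suc i) m)"
    using bias_power[OF assms(1), of "Suc i"] by (simp add: q_Suc mult.commute)
  also have "\<dots> = (\<Sum>m | m dvd q i. \<Sum>n | n dvd W i. real (ell k (m * n)) * bias_max (Suc i) (m * n))"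
    using coprime_W_q by (intro sum_divisors_coprime q_pos W_pos) (simp add: coprime_commute)
  also have "\<dots> \<le> (\<Sum>m | m dvd q i. \<Sum>n | n dvd W i. (real (ell k m) * bias_max i m / c) * (real (ell k n) * exp (lam * real (omega n)) / real n))"
  proof (intro sum_mono)
    fix m n assume "m \<in> {m. m dvd q i}" "n \<in> {n. n dvd W i}"
    then have mn: "m dvd q i" "n dvd W i" by auto
    have pos: "m > 0" "n > 0" using mn q_pos[of i] W_pos[of i] by (auto intro!: Nat.gr0I)
    have "coprime m n" using coprime_divisors[OF mn(2,1) coprime_W_q] by (simp add: coprime_commute)
    then have "real (ell k (m * n)) * bias_max (Suc i) (m * n) = real (ell k m) * real (ell k n) * bias_max (Suc i) (m * n)"
      using ell_mult pos by simp
    also have "\<dots> \<le> real (ell k m) * real (ell k n) * (?e n * bias_max i m / c)"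
      by (intro mult_left_mono max_le mn) simp
    finally show "real (ell k (m * n)) * bias_max (Suc i) (m * n)
      \<le> (real (ell k m) * bias_max i m / c) * (real (ell k n) * exp (lam * real (omega n)) / real n)"
      by (simp add: algebra_simps)
  qed
  also have "\<dots> = bias Ms a P lam k i ^ k / c * (\<Sum>n | n dvd W i. real (ell k n) * exp (lam * real (omega n)) / real n)"
    by (simp add: bias_power[OF assms(1)] sum_product sum_divide_distrib)
  also have "(\<Sum>n | n dvd W i. real (ell k n) * exp (lam * real (omega n)) / real n)
      = (\<Prod>p\<in>G i. 1 + exp lam * (\<Sum>j = 1..v Ms p. real (ell k (p ^ j)) / real p ^ j))"
    unfolding W_def using ell_1[of k] ell_mult by (intro sum_divisors_exp_omega finite_G prime_G) auto
  also have "\<dots> = (\<Prod>p\<in>G i. 1 + exp lam * (\<Sum>j = 1..v Ms p. (real (j + 1) ^ k - real j ^ k) / real p ^ j))"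
    using prime_G by (intro prod.cong refl arg_cong2[of _ _ _ _ "(+)"] arg_cong2[of _ _ _ _ "(*)"] sum.cong)
      (simp add: ell_prime_power)
  finally show ?thesis .
qed

section \<open>The mass of the classes that are not good\<close>

text \<open>A divisor \<open>m\<close> contributes only if its congruence is compatible with
  \<open>r\<close>, and then at most one class: since \<open>n\<close> is coprime to
  \<open>q i\<close>, congruences modulo \<open>q i\<close> and \<open>m * n\<close> fix the class
  modulo \<open>n * q i\<close>.\<close>

lemma num_classes_A_le:
  assumes "n \<in> N i"
  shows "num_classes (n * q i) (A i n r)
    \<le> card {m \<in> {m. m dvd q i \<and> m * n \<in> moduli Ms P (Suc i)}. [r = a (m * n)] (mod int m)}"
proof -
  let ?D = "{m \<in> {m. m dvd q i \<and> m * n \<in> moduli Ms P (Suc i)}. [r = a (m * n)] (mod int m)}"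
  let ?X = "\<lambda>m. res_class r (q i) \<inter> res_class (a (m * n)) (m * n)"
  have n: "n dvd W i" "n > 0" using assms by (auto simp: N_eq)
  have finD: "finite ?D"
    by (rule finite_subset[OF _ finite_divisors_nat[OF q_pos[of i]]]) auto
  have "A i n r \<subseteq> (\<Union>m\<in>?D. ?X m)"
  proof
    fix x assume "x \<in> A i n r"
    then obtain m where m: "m dvd q i" "m * n \<in> moduli Ms P (Suc i)" "x \<in> ?X m"
      by (auto simp: new_set_def)
    then have "[x = r] (mod int m)" "[x = a (m * n)] (mod int m)"
      by (auto simp: res_class_def intro: cong_dvd_modulus)
    then have "[r = a (m * n)] (mod int m)" by (meson cong_sym cong_trans)
    then show "x \<in> (\<Union>m\<in>?D. ?X m)" using m by blast
  qed
  then have "classes_mod (n * q i) (A i n r) \<subseteq> (\<Union>m\<in>?D. classes_mod (n * q i) (?X m))"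
    unfolding classes_mod_def by blast
  then have "num_classes (n * q i) (A i n r) \<le> card (\<Union>m\<in>?D. classes_mod (n * q i) (?X m))"
    unfolding num_classes_def using finD n q_pos[of i] finite_classes_mod by (intro card_mono) auto
  also have "\<dots> \<le> (\<Sum>m\<in>?D. card (classes_mod (n * q i) (?X m)))" by (rule card_UN_le[OF finD])
  also have "\<dots> \<le> (\<Sum>m\<in>?D. 1)"
  proof (rule sum_mono)
    fix m assume "m \<in> ?D"
    have "x mod int (n * q i) = y mod int (n * q i)" if "x \<in> ?X m" "y \<in> ?X m" for x y
    proof -
      have "[x = y] (mod int (q i))" "[x = y] (mod int (m * n))"
        using that unfolding res_class_def by (auto intro: cong_trans cong_sym)
      moreover have "coprime n (q i)" using coprime_divisors[OF n(1) dvd_refl coprime_W_q] .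
      ultimately have "[x = y] (mod int n * int (q i))"
        by (intro coprime_cong_mult) (auto intro: cong_dvd_modulus)
      then show ?thesis by (simp add: cong_def)
    qed
    then have "z = w" if "z \<in> classes_mod (n * q i) (?X m)" "w \<in> classes_mod (n * q i) (?X m)" for z w
      using that unfolding classes_mod_def by blast
    then show "card (classes_mod (n * q i) (?X m)) \<le> 1"
      by (intro card_le_Suc0_iff_eq[THEN iffD2, folded One_nat_def] finite_classes_mod) (use n q_pos in auto)
  qed
  finally show ?thesis by simp
qed

text \<open>Markov's inequality for the \<open>k\<close>th moment of \<open>g p\<close>, with a
  union bound over the new primes. \<open>g p r\<close> counts compatible congruences and majorises
  the sum that defines goodness at \<open>p\<close>.\<close>

lemma bad_mass_le:
  assumes k: "k \<ge> 1" and T: "\<mu> i (T i) > 0" and X: "X \<ge> 0"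
    and bound: "\<And>p. p \<in> G i \<Longrightarrow>
      (\<Sum>n | n \<in> N i \<and> p dvd n. exp (lam * real (omega n)) / real n) \<le> X / (real p - 1)"
  shows "\<mu> i (T i) - \<mu> i (good_set i) \<le> \<mu> i (T i) *
    ((X / (1 - exp (- lam))) ^ k * bias Ms a P lam k i ^ k * (\<Sum>p\<in>G i. 1 / (real p - 1) ^ k))"
proof -
  define c where "c = 1 - exp (- lam)"
  have c: "c > 0" using lam_pos by (simp add: c_def)
  let ?C = "T i \<inter> {0..<int (q i)}"
  let ?D = "\<lambda>n. {m. m dvd q i \<and> m * n \<in> moduli Ms P (Suc i)}"
  let ?w = "\<lambda>n. exp (lam * real (omega n)) / real n"
  let ?N = "\<lambda>p. {n. n \<in> N i \<and> p dvd n}"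
  define g where "g p r = (\<Sum>n\<in>?N p. ?w n * real (card {m \<in> ?D n. [r = a (m * n)] (mod int m)}))" for p r
  have finN: "finite (?N p)" for p
    by (rule finite_subset[OF _ finite_divisors_nat[OF W_pos[of i]]]) (auto simp: N_eq)
  have g0: "g p r \<ge> 0" for p r unfolding g_def by (intro sum_nonneg) auto
  \<comment> \<open>At a class that is not good, some \<open>g p r\<close> exceeds the threshold
    \<open>c\<close>; summing over all \<open>p\<close> avoids choosing which one.\<close>
  have bad: "1 \<le> (\<Sum>p\<in>G i. (g p r / c) ^ k)" if bad: "\<not> is_good i r" for r
  proof -
    obtain p where "p \<in> G i" "\<not> (\<Sum>n\<in>?N p. real (num_classes (n * q i) (A i n r)) * exp (lam * real (omega n)) / real n) \<le> c"
      using bad unfolding good_def c_def by blast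
    then have p: "p \<in> G i" "c < (\<Sum>n\<in>?N p. real (num_classes (n * q i) (A i n r)) * exp (lam * real (omega n)) / real n)"
      by simp_all
    note p(2)
    also have "(\<Sum>n\<in>?N p. real (num_classes (n * q i) (A i n r)) * exp (lam * real (omega n)) / real n)
        = (\<Sum>n\<in>?N p. ?w n * real (num_classes (n * q i) (A i n r)))"
      by (simp add: mult.commute)
    also have "\<dots> \<le> g p r"
      unfolding g_def using num_classes_A_le by (intro sum_mono mult_left_mono of_nat_mono) auto
    finally have "1 \<le> (g p r / c) ^ k" using c by (intro one_le_power) simp
    also have "\<dots> \<le> (\<Sum>p\<in>G i. (g p r / c) ^ k)"
      using p(1) c g0 by (intro member_le_sum finite_G) auto
    finally show ?thesis .
  qed
  have moment: "(\<Sum>r\<in>?C. mass i r * g p r ^ k) \<le> (X / (real p - 1)) ^ k * (bias Ms a P lam k i ^ k * \<mu> i (T i))"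
    if p: "p \<in> G i" for p
  proof -
    have "(\<Sum>r\<in>?C. mass i r * g p r ^ k)
        \<le> sum ?w (?N p) ^ k * (\<Sum>m | m dvd q i. real (ell k m) * (bias_max i m * \<mu> i (T i)))"
      unfolding g_def
    proof (rule moment_bound[OF q_pos])
      \<comment> \<open>\<open>K m\<close> is the largest share of a class modulo \<open>m\<close>,
        rescaled by the total mass, so that the sum against \<open>ell k\<close> is the
        \<open>k\<close>th power of the bias.\<close>
      fix m b assume m: "m dvd q i"
      then have "m > 0" using q_pos[of i] by (auto intro!: Nat.gr0I)
      then have "\<mu> i (T i \<inter> res_class b m) \<le> bias_max i m * \<mu> i (T i)"
        using bias_max_ge[of m i b] T by (simp add: divide_le_eq)
      then show "(\<Sum>r | r \<in> ?C \<and> [r = b] (mod int m). mass i r) \<le> bias_max i m * \<mu> i (T i)"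
        by (simp only: \<mu>_T_class[OF m])
    qed (auto simp: mass_nonneg finN)
    also have "(\<Sum>m | m dvd q i. real (ell k m) * (bias_max i m * \<mu> i (T i))) = bias Ms a P lam k i ^ k * \<mu> i (T i)"
      by (simp add: bias_power[OF k] sum_distrib_right mult.assoc)
    also have "sum ?w (?N p) ^ k * (bias Ms a P lam k i ^ k * \<mu> i (T i))
        \<le> (X / (real p - 1)) ^ k * (bias Ms a P lam k i ^ k * \<mu> i (T i))"
      using T bias_pos[OF k T] by (intro mult_right_mono power_mono bound p sum_nonneg) auto
    finally show ?thesis .
  qed
  have "\<mu> i (T i) - \<mu> i (good_set i) = (\<Sum>r\<in>?C - good_set i \<inter> {0..<int (q i)}. mass i r)"
    unfolding \<mu>_periodic[OF periodic_T] \<mu>_periodic[OF periodic_good_set]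
    using good_set_subset by (intro sum_diff[symmetric]) auto
  also have "\<dots> \<le> (\<Sum>r\<in>?C - good_set i \<inter> {0..<int (q i)}. mass i r * (\<Sum>p\<in>G i. (g p r / c) ^ k))"
  proof (rule sum_mono)
    fix r assume "r \<in> ?C - good_set i \<inter> {0..<int (q i)}"
    then have "\<not> is_good i r" using mem_good_set_iff by auto
    then show "mass i r \<le> mass i r * (\<Sum>p\<in>G i. (g p r / c) ^ k)"
      using mult_left_mono[OF bad mass_nonneg[of i r]] by simp
  qed
  also have "\<dots> \<le> (\<Sum>r\<in>?C. mass i r * (\<Sum>p\<in>G i. (g p r / c) ^ k))"
    using g0 c mass_nonneg by (intro sum_mono2 mult_nonneg_nonneg sum_nonneg) auto
  also have "\<dots> = (\<Sum>p\<in>G i. (\<Sum>r\<in>?C. mass i r * g p r ^ k) / c ^ k)"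
    unfolding sum_distrib_left by (subst sum.swap) (simp add: power_divide sum_divide_distrib)
  also have "\<dots> \<le> (\<Sum>p\<in>G i. (X / (real p - 1)) ^ k * (bias Ms a P lam k i ^ k * \<mu> i (T i)) / c ^ k)"
    using c by (intro sum_mono divide_right_mono moment) auto
  also have "\<dots> = \<mu> i (T i) * ((X / c) ^ k * bias Ms a P lam k i ^ k * (\<Sum>p\<in>G i. 1 / (real p - 1) ^ k))"
    unfolding sum_distrib_left by (rule sum.cong) (simp_all add: power_divide ac_simps)
  finally show ?thesis by (simp add: c_def)
qed

text \<open>The hypothesis supplies a \<open>k\<close> for which \<open>bad_mass_le\<close> leaves
  bad mass at most a proportion 1 - c. It is stated in \<open>ennreal\<close> because the supremum
  may be infinite.\<close>

lemma good_mass_ge: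
  assumes T: "\<mu> i (T i) > 0" and c: "0 < c" "c < 1"
    and hyp: "ennreal (\<Prod>p \<in> G i. 1 + exp lam / (real p - 1))
      \<le> ennreal ((1 - exp (- lam)) / exp lam) *
        (SUP k \<in> {1..}.
           ennreal ((1 - c) powr (1 / real k) / bias Ms a P lam k i) *
           inverse (ennreal ((\<Sum>p \<in> G i. 1 / (real p - 1) ^ k) powr (1 / real k))))"
  shows "\<mu> i (good_set i) \<ge> c * \<mu> i (T i)"
proof (cases "G i = {}")
  \<comment> \<open>Without new primes the power sum is 0 and its inverse infinite, so the
    hypothesis carries no information; but then every class is vacuously good.\<close>
  case True
  then have "is_good i r" for r by (simp add: good_def)
  then have "good_set i = T i" using mem_good_set_iff by auto
  then show ?thesis using T c by simp
next
  case False
  \<comment> \<open>The supremum over \<open>k\<close> need not be attained. Since the divisor sums \<open>h p\<close> are strictly below \<open>prd\<close>,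
    the hypothesis is only needed for some \<open>prd' < prd\<close>, and there a single \<open>k\<close> suffices.\<close>
  define prd where "prd = (\<Prod>p \<in> G i. 1 + exp lam / (real p - 1))"
  \<comment> \<open>The divisor sum at \<open>p\<close> is normalised so that
    \<open>h p <= prd'\<close> is the premise of \<open>bad_mass_le\<close> with X = exp lam *
    prd'.\<close>
  define h where "h p = (\<Sum>n | n \<in> N i \<and> p dvd n. exp (lam * real (omega n)) / real n) * (real p - 1) / exp lam" for p
  define prd' where "prd' = Max (h ` G i)"
  have gt1: "real p > 1" if "p \<in> G i" for p using prime_G[OF that] prime_gt_1_nat by simp
  have h_less: "h p < prd" if p: "p \<in> G i" for p
  proof -
    have "{n. n \<in> N i \<and> p dvd n} = {n. n dvd W i \<and> p dvd n}"
    proof -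
      have "n > 1" if "n dvd W i" "p dvd n" for n
      proof -
        have "n > 0" using that W_pos[of i] by (auto intro!: Nat.gr0I)
        then show ?thesis using dvd_imp_le[OF that(2)] gt1[OF p] by simp
      qed
      then show ?thesis by (auto simp: N_eq)
    qed
    then have "(\<Sum>n | n \<in> N i \<and> p dvd n. exp (lam * real (omega n)) / real n) < exp lam / (real p - 1) * prd"
      using sum_divisors_exp_omega_less[OF finite_G prime_G p, where v = "v Ms" and lam = lam]
      unfolding prd_def W_def by simp
    then show ?thesis using gt1[OF p] by (simp add: h_def field_simps)
  qed
  have h_le: "h p \<le> prd'" if "p \<in> G i" for p
    unfolding prd'_def using that finite_G by (intro Max_ge) auto
  have h0: "h p \<ge> 0" if "p \<in> G i" for p
    unfolding h_def using gt1[OF that] by (intro divide_nonneg_nonneg mult_nonneg_nonneg sum_nonneg) auto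
  have prd'_nonneg: "prd' \<ge> 0" using False h_le h0 by (meson ex_in_conv order_trans)
  have "prd' < prd" unfolding prd'_def using False finite_G h_less by (subst Max_less_iff) auto
  then have "ennreal prd' < ennreal prd" using prd'_nonneg by (simp add: ennreal_less_iff)
  also note hyp[folded prd_def]
  finally obtain k where k: "k \<ge> 1" and less: "ennreal prd' < ennreal ((1 - exp (- lam)) / exp lam) *
      (ennreal ((1 - c) powr (1 / real k) / bias Ms a P lam k i) *
       inverse (ennreal ((\<Sum>p \<in> G i. 1 / (real p - 1) ^ k) powr (1 / real k))))"
    unfolding SUP_mult_left_ennreal less_SUP_iff by auto
  define sg where "sg = (\<Sum>p \<in> G i. 1 / (real p - 1) ^ k)"
  define \<beta> where "\<beta> = bias Ms a P lam k i"
  define c0 where "c0 = 1 - exp (- lam)"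
  have c0: "c0 > 0" using lam_pos by (simp add: c0_def)
  have sg: "sg > 0" unfolding sg_def using False finite_G gt1 by (intro sum_pos) auto
  have \<beta>: "\<beta> > 0" unfolding \<beta>_def by (rule bias_pos[OF k T])
  \<comment> \<open>With \<open>k\<close> fixed and \<open>sg\<close> positive, the inverse is
    finite and the inequality is one between reals.\<close>
  have "ennreal prd' < ennreal (c0 / exp lam * ((1 - c) powr (1 / real k) / \<beta> * inverse (sg powr (1 / real k))))"
    using less sg \<beta> c c0 unfolding sg_def[symmetric] \<beta>_def[symmetric] c0_def[symmetric]
    by (simp add: inverse_ennreal flip: ennreal_mult)
  then have "prd' < c0 / exp lam * ((1 - c) powr (1 / real k) / \<beta> * inverse (sg powr (1 / real k)))"
    using prd'_nonneg by (simp add: ennreal_less_iff)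
  then have less': "exp lam * prd' / c0 \<le> (1 - c) powr (1 / real k) / (\<beta> * sg powr (1 / real k))"
    using c0 \<beta> sg by (simp add: field_simps)
  have pw: "(z powr (1 / real k)) ^ k = z" if "z > 0" for z
    using that k by (simp add: powr_powr flip: powr_realpow)
  have "(exp lam * prd' / c0) ^ k \<le> ((1 - c) powr (1 / real k) / (\<beta> * sg powr (1 / real k))) ^ k"
    using less' prd'_nonneg c0 by (intro power_mono) auto
  also have "\<dots> = (1 - c) / (\<beta> ^ k * sg)"
    using pw[of "1 - c"] pw[OF sg] c by (simp add: power_divide power_mult_distrib)
  finally have main: "(exp lam * prd' / c0) ^ k * \<beta> ^ k * sg \<le> 1 - c"
    using \<beta> sg by (simp add: field_simps)
  have "\<mu> i (T i) - \<mu> i (good_set i) \<le> \<mu> i (T i) *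
    ((exp lam * prd' / (1 - exp (- lam))) ^ k * bias Ms a P lam k i ^ k * (\<Sum>p\<in>G i. 1 / (real p - 1) ^ k))"
  proof (rule bad_mass_le[OF k T])
    show "0 \<le> exp lam * prd'" using prd'_nonneg by simp
    show "(\<Sum>n | n \<in> N i \<and> p dvd n. exp (lam * real (omega n)) / real n) \<le> exp lam * prd' / (real p - 1)"
      if "p \<in> G i" for p
      using h_le[OF that] gt1[OF that] by (simp add: h_def field_simps)
  qed
  also have "\<dots> \<le> \<mu> i (T i) * (1 - c)"
    using main T unfolding sg_def \<beta>_def c0_def by (intro mult_left_mono) auto
  finally show ?thesis by (simp add: algebra_simps)
qed

end

section \<open>Assembling the stage\<close>

theorem theorem2:
  fixes M :: real and Ms :: "nat set" and a :: "nat \<Rightarrow> int" and P :: "nat \<Rightarrow> real"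
    and lam :: real and i :: nat and pi_good :: real
  assumes "M > 0"
    and "finite Ms"
    and "\<And>m. m \<in> Ms \<Longrightarrow> real m > M"
    and "P 0 \<ge> 2"
    and "strict_mono P"
    and "R Ms a P 0 \<noteq> {}"
    and "lam > 0"
    and "0 < pi_good" and "pi_good < 1"
    and "Rstar_pred Ms a P lam i \<inter> R Ms a P i \<noteq> {}"
    and "mu_set Ms a P lam i (Rstar_pred Ms a P lam i \<inter> R Ms a P i) > 0"
    and "ennreal (\<Prod>p \<in> new_primes P i. 1 + exp lam / (real p - 1))
      \<le> ennreal ((1 - exp (- lam)) / exp lam) *
        (SUP k \<in> {1..}.
           ennreal ((1 - pi_good) powr (1 / real k) / bias Ms a P lam k i) *
           inverse (ennreal ((\<Sum>p \<in> new_primes P i. 1 / (real p - 1) ^ k) powr (1 / real k))))"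
  shows "Rstar Ms a P lam i \<subseteq> Rstar_pred Ms a P lam i \<inter> R Ms a P i
    \<and> (\<forall>x y. [x = y] (mod int (Q Ms P i)) \<longrightarrow>
             (x \<in> Rstar Ms a P lam i \<longleftrightarrow> y \<in> Rstar Ms a P lam i))
    \<and> mu_set Ms a P lam i (Rstar Ms a P lam i) /
        mu_set Ms a P lam i (Rstar_pred Ms a P lam i \<inter> R Ms a P i) \<ge> pi_good
    \<and> (\<forall>r \<in> Rstar Ms a P lam i. fibre_density Ms a P i r > 0)
    \<and> (\<forall>k \<ge> 1. bias Ms a P lam k (Suc i) ^ k
         \<le> bias Ms a P lam k i ^ k / pi_good *
           (\<Prod>p \<in> new_primes P i.
              1 + exp lam * (\<Sum>j = 1..v Ms p. (real (j + 1) ^ k - real j ^ k) / real p ^ j)))"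
proof -
  interpret sieve Ms a P lam
    by standard (use assms in auto)
  have T: "\<mu> i (T i) > 0" using assms(11) by (simp add: T_def)
  have mass: "\<mu> i (good_set i) \<ge> pi_good * \<mu> i (T i)" by (rule good_mass_ge[OF T assms(8,9,12)])
  have "good_set i \<subseteq> T i" by (rule good_set_subset)
  moreover have "\<forall>x y. [x = y] (mod int (Q Ms P i)) \<longrightarrow> (x \<in> good_set i \<longleftrightarrow> y \<in> good_set i)"
    using periodic_good_set[of i] by (simp add: periodic_def)
  moreover have "\<mu> i (good_set i) / \<mu> i (T i) \<ge> pi_good" using mass T by (simp add: le_divide_eq)
  moreover have "fibre_density Ms a P i r > 0" if "r \<in> good_set i" for r
  proof -
    \<comment> \<open>The survivors are some of the classes of the fibre, so the denominator of the
      density is positive as well.\<close>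
    have pos: "num_classes (q (Suc i)) (S (Suc i) \<inter> res_class r (q i)) > 0"
      by (rule fibre_local_lemma(1)[OF good_set_local[OF that]])
    also have "\<dots> \<le> num_classes (q (Suc i)) (res_class r (q i))"
      unfolding num_classes_def using finite_classes_mod[OF q_pos]
      by (intro card_mono) (auto simp: classes_mod_def)
    finally show ?thesis using pos by (simp add: fibre_density_def)
  qed
  moreover have "\<forall>k \<ge> 1. bias Ms a P lam k (Suc i) ^ k
         \<le> bias Ms a P lam k i ^ k / pi_good *
           (\<Prod>p \<in> new_primes P i.
              1 + exp lam * (\<Sum>j = 1..v Ms p. (real (j + 1) ^ k - real j ^ k) / real p ^ j))"
    using bias_Suc_le[OF _ assms(8) T mass] by blast
  ultimately show ?thesis unfolding T_def good_set_def by blast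
qed

end
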